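(* Let $\kappa\ge\kappa_0\sqrt5$, let $\mathcal R=\{1,\dots,R_{\max}\}$ with $2\widetilde R_{\max}\le n$, and let $\widehat\lambda^{\widehat R}$ be the adaptive estimator with tuning constant $\kappa$ defined in the context. Let $s>0$ and assume that $R_{\max}$ is such that, for a constant $c>0$, $c\,n^{\frac1{2s+\mathbf d-1}}\le R_{\max}$ (for instance $cn\le2\widetilde R_{\max}\le n$ with a constant $0<c<1$). Assume that $\mathbf p$ belongs to the weighted Sobolev space $Z^s_{w_\beta}((-1,1))$. Then there exists a constant $C>0$ depending only on $\|\mathbf p\|^*_{Z^s_{w_\beta}((-1,1))}$, $s$ and $\mathbf d$ (and on the fixed constants $\kappa$ and $c$) such that $$\mathbb E[\delta_2^2(\widehat\lambda^{\widehat R},\lambda^\star)]\le C\Big[\frac n{\log n}\Big]^{-\frac{2s}{2s+(\mathbf d-1)}}.$$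
   Context: Model: $\mathbf d\ge3$ is an integer, $\mathbb S^{\mathbf d-1}$ the unit sphere of $\mathbb R^{\mathbf d}$ with uniform probability measure $\sigma$. $\mathbf p:[-1,1]\to[0,1]$ is a measurable (envelope) function and $W(x,y)=\mathbf p(\langle x,y\rangle)$. $X_1,\dots,X_n$ are i.i.d. with law $\sigma$; conditionally on them, $\mathbf A$ is a symmetric $n\times n$ $\{0,1\}$-matrix with zero diagonal and independent entries $\mathbf A_{ij}$, $i<j$, with $\mathbb P(\mathbf A_{ij}=1)=W(X_i,X_j)$. Put $\widehat{\mathbf T}_n=\frac1n\mathbf A$ and let $\lambda=(\lambda_1,\dots,\lambda_n)$ be its spectrum. Harmonic notation: $\beta=(\mathbf d-2)/2$, $w_\beta(t)=(1-t^2)^{\beta-1/2}$, $G_\ell^\beta$ is the Gegenbauer polynomial of degree $\ell$ (standard normalization), $c_\ell=\frac{2\ell+\mathbf d-2}{\mathbf d-2}$, $b_{\mathbf d}=\frac{\Gamma(\mathbf d/2)}{\Gamma(1/2)\Gamma(\mathbf d/2-1/2)}$; $d_0=1$, $d_1=\mathbf d$, $d_\ell=\binom{\ell+\mathbf d-1}{\ell}-\binom{\ell+\mathbf d-3}{\ell-2}$ for $\ell\ge2$; $\widetilde R=\sum_{\ell=0}^Rd_\ell$ (and $\widetilde R'$, $\widetilde R_{\max}$ similarly). For $f\in L^2((-1,1),w_\beta)$ put $f_\ell^\star=\frac{c_\ell b_{\mathbf d}}{d_\ell}\int_{-1}^1f(t)G_\ell^\beta(t)w_\beta(t)\,dt$,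 so that $f=\sum_{\ell\ge0}f_\ell^\star c_\ell G_\ell^\beta$ in $L^2$. The weighted Sobolev space $Z^s_{w_\beta}((-1,1))$ is the set of such $f$ with $$\|f\|^*_{Z^s_{w_\beta}((-1,1))}=\Big[\sum_{\ell\ge0}d_\ell|f_\ell^\star|^2\big(1+(\ell(\ell+2\beta))^s\big)\Big]^{1/2}<\infty.$$ The spectrum of the integral operator $\mathbb T_W$ with kernel $W$ on $L^2(\sigma)$ is $\lambda^\star=(\mathbf p_0^\star,\mathbf p_1^\star,\dots,\mathbf p_1^\star,\dots,\mathbf p_\ell^\star,\dots,\mathbf p_\ell^\star,\dots)$, each $\mathbf p_\ell^\star$ repeated $d_\ell$ times, and $\lambda^{\star R}$ is its truncation to $\ell\le R$. Estimators (for $n\ge\widetilde R$): $\mathcal M_R\subset\mathbb R^{\widetilde R}$ is the set of vectors $(u_0,u_1,\dots,u_1,\dots,u_R,\dots,u_R)$ with each $u_\ell\in\mathbb R$ repeated $d_\ell$ times, and $$\widehat\lambda^R\in\arg\min_{u\in\mathcal M_R}\min_{\tau\in\mathfrak S_n}\Big\{\sum_{k=1}^{\widetilde R}(u_k-\lambda_{\tau(k)})^2+\sum_{k=\widetilde R+1}^n\lambda_{\tau(k)}^2\Big\},$$ $\mathfrak S_n$ being the permutations of $\{1,\dots,n\}$. For square-summable real sequences $x,y$ (finite ones completed by infinitely many zeros), $\delta_2(x,y)=\inf_\pi[\sum_i(x_i-y_{\pi(i)})^2]^{1/2}$ over permutations $\pi$ with finite support. For $\kappa>0$, $$B(R)=\max_{R'\in\mathcal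 R}\Big\{\delta_2(\widehat\lambda^{R'},\widehat\lambda^{R'\wedge R})-\kappa\sqrt{\tfrac{\widetilde R'\log n}n}\Big\},\qquad\widehat R\in\arg\min_{R\in\mathcal R}\Big\{B(R)+\kappa\sqrt{\tfrac{\widetilde R\log n}n}\Big\}.$$ Constant $\kappa_0$: a universal constant such that for all $R\ge0$, $\alpha\in(0,1)$ and $n^3\ge(2\widetilde R)^3\vee\widetilde R\log(2\widetilde R/\alpha)$, with probability greater than $1-3\alpha$, $\delta_2(\widehat\lambda^R,\lambda^{\star R})\le4\delta_2(\lambda^{\star R},\lambda^\star)+\kappa_0\sqrt{\widetilde R(1+\log(\widetilde R/\alpha))/n}$. *)

theory Defs
  imports
    "HOL-Probability.Probability"
    "HOL-Combinatorics.Permutations"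
    "Jordan_Normal_Form.Char_Poly"
begin

subsection \<open>The random graph model\<close>

text \<open>
  The uniform probability measure on the unit sphere is the law of \<open>x / norm x\<close> for \<open>x\<close> uniform on
  the unit ball (normalized cone measure, which coincides with normalized surface measure).
  The underlying space is the sphere itself.
\<close>

definition sphere_measure :: "(real^'d::finite) measure" where
  "sphere_measure =
     restrict_space
       (distr (uniform_measure lborel (ball 0 1)) borel (\<lambda>x. x /\<^sub>R norm x))
       (sphere 0 1)"

definition envelope :: "(real \<Rightarrow> real) \<Rightarrow> bool" where
  "envelope p \<longleftrightarrow>
     p \<in> borel_measurable (restrict_space borel {-1..1}) \<and> p ` {-1..1} \<subseteq> {0..1}"

definition edge_slots :: "nat \<Rightarrow> (nat \<times> nat) set" where
  "edge_slots n = {(i, j). i < j \<and> j < n}"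

definition adj_matrix :: "nat \<Rightarrow> (nat \<times> nat \<Rightarrow> bool) \<Rightarrow> real mat" where
  "adj_matrix n e = mat n n (\<lambda>(i, j). if i \<noteq> j \<and> e (min i j, max i j) then 1 else 0)"

definition adjacency_matrices :: "nat \<Rightarrow> real mat set" where
  "adjacency_matrices n =
     {A \<in> carrier_mat n n.
        (\<forall>i<n. \<forall>j<n. A $$ (i, j) \<in> {0, 1} \<and> A $$ (i, j) = A $$ (j, i)) \<and>
        (\<forall>i<n. A $$ (i, i) = 0)}"

text \<open>
  The law of the adjacency matrix (on the discrete \<open>\<sigma>\<close>-algebra): draw i.i.d. uniform latent points,
  then independent Bernoulli edges given the points. The type argument carries the dimension.
\<close>

definition graph_law :: "'d::finite itself \<Rightarrow> (real \<Rightarrow> real) \<Rightarrow> nat \<Rightarrow> real mat measure" where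
  "graph_law _ p n =
     (\<Pi>\<^sub>M i\<in>{..<n}. (sphere_measure :: (real^'d) measure)) \<bind>
       (\<lambda>x. measure_pmf (map_pmf (adj_matrix n)
          (Pi_pmf (edge_slots n) False (\<lambda>(i, j). bernoulli_pmf (p (inner (x i) (x j)))))))"

text \<open>
  Eigenvalues of \<open>A / n\<close> with algebraic multiplicity; for symmetric \<open>A\<close> the characteristic
  polynomial splits over the reals, so this list has length \<open>n\<close>.
\<close>

definition graph_spectrum :: "nat \<Rightarrow> real mat \<Rightarrow> real list" where
  "graph_spectrum n A =
     sorted_list_of_multiset (proots (char_poly ((1 / real n) \<cdot>\<^sub>m A)))"


subsection \<open>Gegenbauer expansions and weighted Sobolev spaces\<close>

definition geg_index :: "nat \<Rightarrow> real" where
  "geg_index d = (real d - 2) / 2"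

definition geg_weight :: "nat \<Rightarrow> real \<Rightarrow> real" where
  "geg_weight d t = (1 - t\<^sup>2) powr (geg_index d - 1/2)"

text \<open>
  Three-term recurrence for the standard normalization, i.e. the coefficients of
  \<open>(1 - 2 t r + r^2) powr (-\<beta>)\<close> as a power series in \<open>r\<close>.
\<close>

fun gegenbauer :: "real \<Rightarrow> nat \<Rightarrow> real \<Rightarrow> real" where
  "gegenbauer \<beta> 0 t = 1"
| "gegenbauer \<beta> (Suc 0) t = 2 * \<beta> * t"
| "gegenbauer \<beta> (Suc (Suc k)) t =
     (2 * t * (real k + 1 + \<beta>) * gegenbauer \<beta> (Suc k) t
       - (real k + 2 * \<beta>) * gegenbauer \<beta> k t) / (real k + 2)"

definition geg_c :: "nat \<Rightarrow> nat \<Rightarrow> real" where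
  "geg_c d l = (2 * real l + real d - 2) / (real d - 2)"

definition geg_b :: "nat \<Rightarrow> real" where
  "geg_b d = Gamma (real d / 2) / (Gamma (1/2) * Gamma (real d / 2 - 1/2))"

definition harm_dim :: "nat \<Rightarrow> nat \<Rightarrow> nat" where
  "harm_dim d l =
     (if l = 0 then 1 else if l = 1 then d
      else ((l + d - 1) choose l) - ((l + d - 3) choose (l - 2)))"

definition cum_dim :: "nat \<Rightarrow> nat \<Rightarrow> nat" where
  "cum_dim d R = (\<Sum>l\<le>R. harm_dim d l)"

definition geg_coeff :: "nat \<Rightarrow> (real \<Rightarrow> real) \<Rightarrow> nat \<Rightarrow> real" where
  "geg_coeff d f l =
     geg_c d l * geg_b d / real (harm_dim d l) *
     (LBINT t:{-1<..<1}. f t * gegenbauer (geg_index d) l t * geg_weight d t)"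

definition sobolev_term :: "nat \<Rightarrow> real \<Rightarrow> (real \<Rightarrow> real) \<Rightarrow> nat \<Rightarrow> real" where
  "sobolev_term d s f l =
     real (harm_dim d l) * \<bar>geg_coeff d f l\<bar>\<^sup>2 *
     (1 + (real l * (real l + 2 * geg_index d)) powr s)"

definition weighted_L2 :: "nat \<Rightarrow> (real \<Rightarrow> real) set" where
  "weighted_L2 d =
     {f. set_borel_measurable lborel {-1<..<1} f \<and>
         set_integrable lborel {-1<..<1} (\<lambda>t. (f t)\<^sup>2 * geg_weight d t)}"

definition sobolev_space :: "nat \<Rightarrow> real \<Rightarrow> (real \<Rightarrow> real) set" where
  "sobolev_space d s = {f \<in> weighted_L2 d. summable (sobolev_term d s f)}"

definition sobolev_norm :: "nat \<Rightarrow> real \<Rightarrow> (real \<Rightarrow> real) \<Rightarrow> real" where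
  "sobolev_norm d s f = sqrt (\<Sum>l. sobolev_term d s f l)"


subsection \<open>Spectra as sequences\<close>

text \<open>
  Finite vectors are represented by their completion with zeros, so that they can be compared with
  infinite sequences; indices start at 0. Position \<open>k\<close> lies in the block of degree \<open>l\<close> iff
  \<open>cum_dim d (l - 1) \<le> k < cum_dim d l\<close> (with \<open>0 \<le> k < 1\<close> for \<open>l = 0\<close>).
\<close>

definition degree_at :: "nat \<Rightarrow> nat \<Rightarrow> nat" where
  "degree_at d k = (LEAST l. k < cum_dim d l)"

definition block_vector :: "nat \<Rightarrow> nat \<Rightarrow> (nat \<Rightarrow> real) \<Rightarrow> nat \<Rightarrow> real" where
  "block_vector d R v k = (if k < cum_dim d R then v (degree_at d k) else 0)"

definition lambda_star :: "nat \<Rightarrow> (real \<Rightarrow> real) \<Rightarrow> nat \<Rightarrow> real" where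
  "lambda_star d p k = geg_coeff d p (degree_at d k)"

definition lambda_star_trunc :: "nat \<Rightarrow> (real \<Rightarrow> real) \<Rightarrow> nat \<Rightarrow> nat \<Rightarrow> real" where
  "lambda_star_trunc d p R = block_vector d R (geg_coeff d p)"

definition \<delta>\<^sub>2 :: "(nat \<Rightarrow> real) \<Rightarrow> (nat \<Rightarrow> real) \<Rightarrow> real" where
  "\<delta>\<^sub>2 x y =
     (INF \<pi>\<in>{\<pi>. bij \<pi> \<and> finite {i. \<pi> i \<noteq> i}}. sqrt (\<Sum>i. (x i - y (\<pi> i))\<^sup>2))"


subsection \<open>Estimators\<close>

definition model_space :: "nat \<Rightarrow> nat \<Rightarrow> (nat \<Rightarrow> real) set" where
  "model_space d R = range (block_vector d R)"

definition fit_cost :: "nat \<Rightarrow> nat \<Rightarrow> nat \<Rightarrow> real list \<Rightarrow> (nat \<Rightarrow> real) \<Rightarrow> real" where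
  "fit_cost d n R lam u =
     Min ((\<lambda>\<tau>. (\<Sum>k<cum_dim d R. (u k - lam ! \<tau> k)\<^sup>2) + (\<Sum>k=cum_dim d R..<n. (lam ! \<tau> k)\<^sup>2))
          ` {\<tau>. \<tau> permutes {..<n}})"

text \<open>
  \<open>u\<close> is an admissible value of the resolution-\<open>R\<close> estimator for the adjacency matrix \<open>A\<close>
  (minimizers need not be unique).
\<close>

definition is_estimate :: "nat \<Rightarrow> nat \<Rightarrow> nat \<Rightarrow> real mat \<Rightarrow> (nat \<Rightarrow> real) \<Rightarrow> bool" where
  "is_estimate d n R A u \<longleftrightarrow>
     is_arg_min (fit_cost d n R (graph_spectrum n A)) (\<lambda>u. u \<in> model_space d R) u"

definition penalty :: "nat \<Rightarrow> nat \<Rightarrow> real \<Rightarrow> nat \<Rightarrow> real" where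
  "penalty d n \<kappa> R = \<kappa> * sqrt (real (cum_dim d R) * ln (real n) / real n)"

text \<open>Below, \<open>est\<close> is the family of estimators, indexed by the resolution.\<close>

definition adaptive_B ::
  "nat \<Rightarrow> nat \<Rightarrow> real \<Rightarrow> nat \<Rightarrow> (nat \<Rightarrow> nat \<Rightarrow> real) \<Rightarrow> nat \<Rightarrow> real" where
  "adaptive_B d n \<kappa> Rmax est R =
     Max ((\<lambda>R'. \<delta>\<^sub>2 (est R') (est (min R' R)) - penalty d n \<kappa> R') ` {1..Rmax})"

definition is_adaptive_resolution ::
  "nat \<Rightarrow> nat \<Rightarrow> real \<Rightarrow> nat \<Rightarrow> (nat \<Rightarrow> nat \<Rightarrow> real) \<Rightarrow> nat \<Rightarrow> bool" where
  "is_adaptive_resolution d n \<kappa> Rmax est Rhat \<longleftrightarrow>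
     is_arg_min (\<lambda>R. adaptive_B d n \<kappa> Rmax est R + penalty d n \<kappa> R) (\<lambda>R. R \<in> {1..Rmax}) Rhat"

text \<open>
  The defining property of the constant \<open>\<kappa>\<^sub>0\<close>, in dimension \<open>CARD('d)\<close>: it holds for all envelope
  functions and all ways of selecting minimizers (as functions of the observed matrix).
\<close>

definition concentration_constant :: "'d::finite itself \<Rightarrow> real \<Rightarrow> bool" where
  "concentration_constant T \<kappa>\<^sub>0 \<longleftrightarrow>
     (let d = CARD('d) in
      \<forall>p R (\<alpha>::real) n est.
        envelope p \<longrightarrow> 0 < \<alpha> \<longrightarrow> \<alpha> < 1 \<longrightarrow>
        real n ^ 3 \<ge> max ((2 * real (cum_dim d R)) ^ 3)
                         (real (cum_dim d R) * ln (2 * real (cum_dim d R) / \<alpha>)) \<longrightarrow>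
        (\<forall>A\<in>adjacency_matrices n. is_estimate d n R A (est A)) \<longrightarrow>
        measure (graph_law T p n)
          {A. \<delta>\<^sub>2 (est A) (lambda_star_trunc d p R)
                \<le> 4 * \<delta>\<^sub>2 (lambda_star_trunc d p R) (lambda_star d p)
                  + \<kappa>\<^sub>0 * sqrt (real (cum_dim d R) * (1 + ln (real (cum_dim d R) / \<alpha>)) / real n)}
          > 1 - 3 * \<alpha>)"

end

theory Submission
  imports Defs
begin

text \<open>
  At confidence level \<open>\<alpha> = n\<^sup>-\<^sup>3\<close> the defining property of \<open>\<kappa>\<^sub>0\<close> says that, outside an event of
  probability \<open>O (n\<^sup>-\<^sup>2)\<close>, every estimator errs by at most four times its bias plus its penalty. Off
  that event the Goldenshluger-Lepski comparison gives, for every resolution \<open>R\<close>, an error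
  of at most \<open>23 t + 5 penalty R\<close>, where \<open>t = \<parallel>p\<parallel> R\<^sup>-\<^sup>s\<close> bounds the tail of the spectrum beyond degree \<open>R\<close>;
  since the first \<open>R\<close> degrees span \<open>O (R\<^sup>d\<^sup>-\<^sup>1)\<close> coordinates, \<open>R\<close> of order \<open>(n / ln n)\<close> to the power
  \<open>1 / (2 s + d - 1)\<close> balances both terms. On the exceptional event a crude bound suffices: the
  \<open>n\<close> eigenvalues of \<open>A / n\<close> lie in \<open>[-1, 1]\<close>, so that the squared error is \<open>O (n)\<close>.
\<close>

subsection \<open>The law of the graph\<close>

lemma finite_edge_slots: "finite (edge_slots n)"
  by (rule finite_subset[of _ "{..<n} \<times> {..<n}"]) (auto simp: edge_slots_def)

lemma adj_matrix_adjacency: "adj_matrix n e \<in> adjacency_matrices n"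
  by (auto simp: adjacency_matrices_def adj_matrix_def min.commute max.commute)

text \<open>Normalisation misses the sphere only at the origin, a Lebesgue null point, so the
  pushforward already gives the sphere mass one and restricting to it loses nothing.\<close>

lemma prob_space_sphere_measure: "prob_space (sphere_measure :: (real^'d::finite) measure)"
proof -
  let ?U = "uniform_measure lborel (ball (0::real^'d) 1)"
  let ?D = "distr ?U borel (\<lambda>x. x /\<^sub>R norm x)"
  have "emeasure lborel (ball (0::real^'d) 1) \<noteq> 0"
  proof
    assume "emeasure lborel (ball (0::real^'d) 1) = 0"
    then have "ball (0::real^'d) 1 \<in> null_sets lborel" by auto
    then have "negligible (ball (0::real^'d) 1)"
      by (metis null_sets_completionI negligible_iff_null_sets)
    then show False using open_not_negligible[of "ball (0::real^'d) 1"] by auto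
  qed
  moreover have "emeasure lborel (ball (0::real^'d) 1) < \<infinity>"
    using emeasure_lborel_ball_finite by (auto simp: top.not_eq_extremum)
  ultimately have "prob_space ?U"
    by (intro prob_space_uniform_measure) auto
  then have D: "prob_space ?D"
    by (rule prob_space.prob_space_distr) auto
  have "AE x in lborel. x \<noteq> (0::real^'d)"
    by (rule AE_lborel_singleton)
  then have "AE x in ?U. x \<noteq> 0"
    by (intro AE_uniform_measureI) auto
  then have "AE x in ?U. x /\<^sub>R norm x \<in> sphere 0 1"
    by eventually_elim auto
  then have "AE y in ?D. y \<in> sphere 0 1"
    by (subst AE_distr_iff) auto
  then have "emeasure ?D (sphere 0 1) = 1"
    using prob_space.emeasure_eq_1_AE[OF D, of "sphere 0 1"] by auto
  then show ?thesis
    unfolding sphere_measure_def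
    by (intro prob_spaceI) (auto simp: emeasure_restrict_space space_restrict_space)
qed

lemma space_sphere_measure: "space (sphere_measure :: (real^'d::finite) measure) = sphere 0 1"
  by (auto simp: sphere_measure_def space_restrict_space)

lemma borel_measurable_sphere_measure:
  assumes "f \<in> borel_measurable borel"
  shows "f \<in> borel_measurable (sphere_measure :: (real^'d::finite) measure)"
  using assms unfolding sphere_measure_def by (intro measurable_restrict_space1) simp

lemma inner_sphere_bounds:
  assumes "x \<in> sphere 0 1" "y \<in> sphere 0 (1::real)"
  shows "inner x y \<in> {-1..(1::real)}"
  using Cauchy_Schwarz_ineq2[of x y] assms by (auto simp: abs_le_iff)

lemma latent_in_sphere:
  assumes "x \<in> space (\<Pi>\<^sub>M i\<in>{..<n}. (sphere_measure :: (real^'d::finite) measure))" "k < n"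
  shows "x k \<in> sphere 0 1"
  using PiE_mem[OF assms(1)[unfolded space_PiM], of k] assms(2)
  by (simp only: space_sphere_measure lessThan_iff)

text \<open>The function \<open>p\<close> is measurable only as a function on [-1, 1], so the inner
  product must first be given that interval as codomain; Cauchy-Schwarz provides this.\<close>

lemma edge_probability_measurable:
  assumes p: "envelope p" and "i < n" "j < n"
  shows "(\<lambda>x. p (inner (x i) (x j))) \<in>
    borel_measurable (\<Pi>\<^sub>M i\<in>{..<n}. (sphere_measure :: (real^'d::finite) measure))"
proof -
  let ?M = "\<Pi>\<^sub>M i\<in>{..<n}. (sphere_measure :: (real^'d::finite) measure)"
  have comp: "(\<lambda>x. x k) \<in> borel_measurable ?M" if "k < n" for k
    using measurable_comp[OF measurable_component_singleton[of k "{..<n}" "\<lambda>_. sphere_measure"]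
        borel_measurable_sphere_measure[of "\<lambda>x. x"]] that by (simp add: comp_def)
  note sph = latent_in_sphere[where n = n and 'd = 'd]
  have "(\<lambda>x. inner (x i) (x j)) \<in> borel_measurable ?M"
    by (intro borel_measurable_inner comp assms)
  then have "(\<lambda>x. inner (x i) (x j)) \<in> measurable ?M (restrict_space borel {-1..1})"
  proof (rule measurable_restrict_space2[rotated])
    show "(\<lambda>x. inner (x i) (x j)) \<in> space ?M \<rightarrow> {-1..1}"
      using inner_sphere_bounds[OF sph[OF _ assms(2)] sph[OF _ assms(3)]] by (rule Pi_I)
  qed
  from measurable_compose[OF this] p show ?thesis
    by (auto simp: envelope_def)
qed

section \<open>The conditional law of the matrix given the latent points\<close>

definition edge_kernel :: "(real \<Rightarrow> real) \<Rightarrow> nat \<Rightarrow> (nat \<Rightarrow> real^'d::finite) \<Rightarrow> real mat pmf" where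
  "edge_kernel p n x = map_pmf (adj_matrix n)
     (Pi_pmf (edge_slots n) False (\<lambda>(i, j). bernoulli_pmf (p (inner (x i) (x j)))))"

text \<open>This is what makes the monadic bind in \<open>graph_law\<close> meaningful. The
  probability of any set of matrices is a finite sum of products of edge probabilities and their
  complements, hence measurable in the latent points.\<close>

lemma edge_kernel_measurable:
  assumes p: "envelope p"
  shows "(\<lambda>x. measure_pmf (edge_kernel p n x)) \<in> measurable
    (\<Pi>\<^sub>M i\<in>{..<n}. (sphere_measure :: (real^'d::finite) measure)) (subprob_algebra (count_space UNIV))"
    (is "_ \<in> measurable ?M _")
proof (rule measurable_subprob_algebra)
  fix A :: "real mat set"
  let ?S = "edge_slots n"
  \<comment> \<open>\<open>Pi_pmf\<close> charges only configurations that take the default value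
    \<open>False\<close> off the slots. Keeping just these leaves a finite set without changing the
    probability.\<close>
  define E where "E = {e \<in> PiE_dflt ?S False (\<lambda>_. UNIV). adj_matrix n e \<in> A}"
  have fE: "finite E"
    by (rule finite_subset[OF _ finite_PiE_dflt[of ?S "\<lambda>_. UNIV" False]])
      (auto simp: E_def finite_edge_slots)
  \<comment> \<open>A parameter in [0, 1] is required for the mass function of
    \<open>bernoulli_pmf\<close> to be the expected one.\<close>
  have pr: "p (inner (x i) (x j)) \<in> {0..1}" if "x \<in> space ?M" "(i,j) \<in> ?S" for x i j
  proof -
    have "x i \<in> sphere 0 1" "x j \<in> sphere 0 1"
      using that latent_in_sphere[of x n] by (auto simp: edge_slots_def)
    from inner_sphere_bounds[OF this] show ?thesis using p unfolding envelope_def by blast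
  qed
  have "emeasure (measure_pmf (edge_kernel p n x)) A =
      ennreal (\<Sum>e\<in>E. \<Prod>(i,j)\<in>?S. if e (i,j) then p (inner (x i) (x j)) else 1 - p (inner (x i) (x j)))"
    if x: "x \<in> space ?M" for x
  proof -
    let ?P = "Pi_pmf ?S False (\<lambda>(i, j). bernoulli_pmf (p (inner (x i) (x j))))"
    have "emeasure (measure_pmf (edge_kernel p n x)) A = emeasure (measure_pmf ?P) (adj_matrix n -` A)"
      by (simp add: edge_kernel_def)
    also have "\<dots> = emeasure (measure_pmf ?P) E"
    proof (rule emeasure_eq_AE)
      have "\<forall>e\<in>set_pmf ?P. (\<forall>s. s \<notin> ?S \<longrightarrow> e s = False)"
        using subsetD[OF set_Pi_pmf_subset[OF finite_edge_slots[of n]]] by fast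
      then show "AE e in measure_pmf ?P. e \<in> adj_matrix n -` A \<longleftrightarrow> e \<in> E"
        unfolding AE_measure_pmf_iff E_def PiE_dflt_def by auto
    qed simp_all
    also have "\<dots> = ennreal (\<Sum>e\<in>E. pmf ?P e)"
      using fE by (simp add: measure_pmf.emeasure_eq_measure measure_measure_pmf_finite)
    also have "(\<Sum>e\<in>E. pmf ?P e) = (\<Sum>e\<in>E. \<Prod>(i,j)\<in>?S. if e (i,j) then p (inner (x i) (x j)) else 1 - p (inner (x i) (x j)))"
    proof (rule sum.cong[OF refl])
      fix e assume "e \<in> E"
      then have "pmf ?P e = (\<Prod>s\<in>?S. pmf ((\<lambda>(i, j). bernoulli_pmf (p (inner (x i) (x j)))) s) (e s))"
        by (intro pmf_Pi' finite_edge_slots) (auto simp: E_def PiE_dflt_def)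
      also have "\<dots> = (\<Prod>(i,j)\<in>?S. if e (i,j) then p (inner (x i) (x j)) else 1 - p (inner (x i) (x j)))"
      proof (rule prod.cong[OF refl])
        fix s assume "s \<in> ?S"
        then show "pmf ((\<lambda>(i, j). bernoulli_pmf (p (inner (x i) (x j)))) s) (e s) =
            (case s of (i,j) \<Rightarrow> if e (i,j) then p (inner (x i) (x j)) else 1 - p (inner (x i) (x j)))"
          using pr[OF x, of "fst s" "snd s"] by (cases s; cases "e s") auto
      qed
      finally show "pmf ?P e = \<dots>" .
    qed
    finally show ?thesis .
  qed
  note kernel = this
  have "(\<lambda>x. ennreal (\<Sum>e\<in>E. \<Prod>(i,j)\<in>?S. if e (i,j) then p (inner (x i) (x j)) else 1 - p (inner (x i) (x j))))
     \<in> borel_measurable ?M"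
  proof (intro measurable_compose[OF _ measurable_ennreal] borel_measurable_sum borel_measurable_prod)
    fix e s assume "s \<in> ?S"
    then obtain i j where s: "s = (i,j)" "i < n" "j < n" by (auto simp: edge_slots_def)
    show "(\<lambda>x. case s of (i,j) \<Rightarrow> if e (i,j) then p (inner (x i) (x j)) else 1 - p (inner (x i) (x j)))
        \<in> borel_measurable ?M"
      unfolding s(1) prod.case
    proof (cases "e (i,j)")
      case True
      then show "(\<lambda>x. if e (i,j) then p (inner (x i) (x j)) else 1 - p (inner (x i) (x j))) \<in> borel_measurable ?M"
        using edge_probability_measurable[OF p s(2,3)] by simp
    next
      case False
      then show "(\<lambda>x. if e (i,j) then p (inner (x i) (x j)) else 1 - p (inner (x i) (x j))) \<in> borel_measurable ?M"
        using borel_measurable_diff[OF borel_measurable_const edge_probability_measurable[OF p s(2,3)]] by simp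
    qed
  qed
  then show "(\<lambda>x. emeasure (measure_pmf (edge_kernel p n x)) A) \<in> borel_measurable ?M"
    by (subst measurable_cong[OF kernel])
qed (simp_all add: measure_pmf.subprob_space_axioms)

lemma AE_edge_kernel: "AE A in measure_pmf (edge_kernel p n x). A \<in> adjacency_matrices n"
  unfolding AE_measure_pmf_iff edge_kernel_def set_map_pmf using adj_matrix_adjacency by blast

lemma prob_space_latent:
  "prob_space (\<Pi>\<^sub>M i\<in>{..<n}. (sphere_measure :: (real^'d::finite) measure))"
  by (intro prob_space_PiM prob_space_sphere_measure)

lemma graph_law_eq_bind:
  "graph_law TYPE('d::finite) p n =
     (\<Pi>\<^sub>M i\<in>{..<n}. (sphere_measure :: (real^'d) measure)) \<bind> (\<lambda>x. measure_pmf (edge_kernel p n x))"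
  unfolding graph_law_def edge_kernel_def ..

lemma prob_space_graph_law:
  assumes "envelope p"
  shows "prob_space (graph_law TYPE('d::finite) p n)"
  unfolding graph_law_eq_bind
  by (rule prob_space.prob_space_bind[OF prob_space_latent _ edge_kernel_measurable[OF assms]])
    (simp add: measure_pmf.prob_space_axioms)

text \<open>Every set of matrices is an event, so arbitrary selections of estimates and resolutions
  are measurable.\<close>

lemma sets_graph_law:
  assumes "envelope p"
  shows "sets (graph_law TYPE('d::finite) p n) = UNIV"
proof -
  have "sets (graph_law TYPE('d) p n) = sets (count_space UNIV)"
    unfolding graph_law_eq_bind
    by (rule sets_bind_measurable[OF edge_kernel_measurable[OF assms] prob_space.not_empty[OF prob_space_latent]])
  then show ?thesis by simp
qed

text \<open>The assumptions on the estimators speak of adjacency matrices only; this confines all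
  pointwise arguments to them.\<close>

lemma AE_graph_law:
  assumes "envelope p"
  shows "AE A in graph_law TYPE('d::finite) p n. A \<in> adjacency_matrices n"
proof -
  let ?M = "\<Pi>\<^sub>M i\<in>{..<n}. (sphere_measure :: (real^'d) measure)"
  let ?K = "\<lambda>x. measure_pmf (edge_kernel p n x)"
  have "(AE A in ?M \<bind> ?K. A \<in> adjacency_matrices n) \<longleftrightarrow>
      (AE x in ?M. AE A in ?K x. A \<in> adjacency_matrices n)"
  proof (rule AE_bind)
    show "?K \<in> measurable ?M (subprob_algebra (count_space UNIV))"
      by (rule edge_kernel_measurable[OF assms])
  qed simp
  then show ?thesis
    unfolding graph_law_eq_bind by (rule iffD2) (rule AE_I2, rule AE_edge_kernel)
qed

subsection \<open>Eigenvalues of adjacency matrices\<close>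

text \<open>The fundamental theorem of algebra yields a complex root, which is real by assumption;
  dividing by its linear factor lowers the degree.\<close>

lemma size_proots_eq_degree:
  fixes p :: "real poly"
  assumes "p \<noteq> 0" and "\<And>z. poly (map_poly complex_of_real p) z = 0 \<Longrightarrow> z \<in> \<real>"
  shows "size (proots p) = degree p"
proof -
  interpret map_poly_hom: map_poly_comm_ring_hom complex_of_real ..
  show ?thesis
    using assms
  proof (induction "degree p" arbitrary: p rule: less_induct)
    case (less p)
    show ?case
    proof (cases "degree p = 0")
      case True
      then show ?thesis using size_proots_le[of p] by simp
    next
      case False
      then have "degree (map_poly complex_of_real p) \<noteq> 0" by simp
      then obtain z where "poly (map_poly complex_of_real p) z = 0"
        by (metis fundamental_theorem_of_algebra constant_degree)
      moreover from this obtain x where x: "z = complex_of_real x"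
        using less.prems(2) Reals_cases by blast
      ultimately have "poly p x = 0" by simp
      then obtain q where q: "p = [:-x, 1:] * q" unfolding poly_eq_0_iff_dvd by (elim dvdE)
      with less.prems have q0: "q \<noteq> 0" by auto
      have "poly (map_poly complex_of_real q) w = 0 \<Longrightarrow> w \<in> \<real>" for w
        using less.prems(2)[of w] by (simp add: q map_poly_hom.hom_mult del: mult_pCons_left)
      moreover have dq: "degree p = Suc (degree q)"
        using q0 by (simp add: q degree_mult_eq del: mult_pCons_left)
      ultimately have "size (proots q) = degree q" using less.hyps[of q] q0 by simp
      moreover have "proots p = {#x#} + proots q"
        using q0 by (simp add: q proots_mult del: mult_pCons_left)
      ultimately show ?thesis using dq by simp
    qed
  qed
qed

text \<open>For an eigenvector v, the form v* M v equals z times the squared norm of v. It is its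
  own conjugate because M is Hermitian, so z is too.\<close>

lemma symmetric_eigenvalue_real:
  fixes M :: "complex mat"
  assumes M: "M \<in> carrier_mat n n" and sym: "\<And>i j. i < n \<Longrightarrow> j < n \<Longrightarrow> M $$ (i,j) = cnj (M $$ (j,i))"
    and "eigenvalue M z"
  shows "z \<in> \<real>"
proof -
  obtain v where v: "v \<in> carrier_vec n" "v \<noteq> 0\<^sub>v n" "M *\<^sub>v v = z \<cdot>\<^sub>v v"
    using assms(1,3) by (auto simp: eigenvalue_def eigenvector_def)
  have row: "(\<Sum>j<n. M $$ (i,j) * v $ j) = z * v $ i" if "i < n" for i
  proof -
    have "(M *\<^sub>v v) $ i = (\<Sum>j<n. M $$ (i,j) * v $ j)"
      using that M v(1) by (simp add: scalar_prod_def lessThan_atLeast0)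
    then show ?thesis using v that by simp
  qed
  define S where "S = (\<Sum>i<n. v $ i * cnj (v $ i))"
  define Q where "Q = (\<Sum>i<n. \<Sum>j<n. cnj (v $ i) * M $$ (i,j) * v $ j)"
  have Q: "Q = z * S"
  proof -
    have "Q = (\<Sum>i<n. cnj (v $ i) * (\<Sum>j<n. M $$ (i,j) * v $ j))"
      by (simp add: Q_def sum_distrib_left mult.assoc)
    also have "\<dots> = (\<Sum>i<n. cnj (v $ i) * (z * v $ i))"
      by (rule sum.cong) (auto simp: row)
    finally show ?thesis by (simp add: S_def sum_distrib_left mult_ac)
  qed
  have "cnj Q = (\<Sum>i<n. \<Sum>j<n. v $ i * cnj (M $$ (i,j)) * cnj (v $ j))"
    by (simp add: Q_def)
  also have "\<dots> = (\<Sum>i<n. \<Sum>j<n. cnj (v $ j) * M $$ (j,i) * v $ i)"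
  proof (intro sum.cong refl)
    fix i j assume "i \<in> {..<n}" "j \<in> {..<n}"
    then show "v $ i * cnj (M $$ (i,j)) * cnj (v $ j) = cnj (v $ j) * M $$ (j,i) * v $ i"
      using sym[of j i] by simp
  qed
  also have "\<dots> = Q" unfolding Q_def by (rule sum.swap)
  finally have "cnj Q = Q" .
  have S: "S = complex_of_real (\<Sum>i<n. (cmod (v $ i))\<^sup>2)"
    unfolding S_def of_real_sum complex_norm_square ..
  have "S \<noteq> 0"
  proof
    assume "S = 0"
    then have "(\<Sum>i<n. (cmod (v $ i))\<^sup>2) = 0" unfolding S by (simp only: of_real_eq_0_iff)
    then have "v $ i = 0" if "i < n" for i using that
      by (subst (asm) sum_nonneg_eq_0_iff) auto
    then have "v = 0\<^sub>v n" using v(1) by (intro eq_vecI) auto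
    then show False using v(2) by simp
  qed
  moreover have "cnj S = S" by (simp add: S)
  moreover have "cnj z * cnj S = z * S" using \<open>cnj Q = Q\<close> unfolding Q by simp
  ultimately have "cnj z = z" by simp
  then show ?thesis by (simp add: Reals_cnj_iff)
qed

text \<open>The eigenvector equation is read off at a coordinate of largest modulus.\<close>

lemma eigenvalue_row_sum_bound:
  fixes M :: "real mat"
  assumes M: "M \<in> carrier_mat n n" and rs: "\<And>i. i < n \<Longrightarrow> (\<Sum>j<n. \<bar>M $$ (i,j)\<bar>) \<le> b"
    and "eigenvalue M z"
  shows "\<bar>z\<bar> \<le> b"
proof -
  obtain v where v: "v \<in> carrier_vec n" "v \<noteq> 0\<^sub>v n" "M *\<^sub>v v = z \<cdot>\<^sub>v v"
    using assms(1,3) by (auto simp: eigenvalue_def eigenvector_def)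
  have "\<exists>k<n. v $ k \<noteq> 0"
  proof (rule ccontr)
    assume "\<not> (\<exists>k<n. v $ k \<noteq> 0)"
    then have "v = 0\<^sub>v n" using v(1) by (intro eq_vecI) auto
    then show False using v(2) by simp
  qed
  then obtain k where k: "k < n" "v $ k \<noteq> 0" by blast
  define m where "m = Max ((\<lambda>i. \<bar>v $ i\<bar>) ` {..<n})"
  have le: "\<bar>v $ i\<bar> \<le> m" if "i < n" for i unfolding m_def using that by (intro Max_ge) auto
  have "m \<in> (\<lambda>i. \<bar>v $ i\<bar>) ` {..<n}" unfolding m_def using k by (intro Max_in) auto
  then obtain i where i: "i < n" "m = \<bar>v $ i\<bar>" by auto
  have "m > 0" using le[OF k(1)] k(2) by simp
  have "(M *\<^sub>v v) $ i = (\<Sum>j<n. M $$ (i,j) * v $ j)"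
    using i M v(1) by (simp add: scalar_prod_def lessThan_atLeast0)
  then have "z * v $ i = (\<Sum>j<n. M $$ (i,j) * v $ j)" using v i by simp
  then have "\<bar>z\<bar> * m = \<bar>\<Sum>j<n. M $$ (i,j) * v $ j\<bar>"
    unfolding i(2) by (simp flip: abs_mult)
  also have "\<dots> \<le> (\<Sum>j<n. \<bar>M $$ (i,j)\<bar> * m)"
    by (rule order_trans[OF sum_abs]) (auto intro!: sum_mono mult_left_mono le simp: abs_mult)
  also have "\<dots> \<le> b * m" using rs[OF i(1)] \<open>m > 0\<close> by (simp add: sum_distrib_right[symmetric])
  finally show ?thesis using \<open>m > 0\<close> by simp
qed

context
  fixes A :: "real mat" and n :: nat
  assumes A: "A \<in> adjacency_matrices n"
begin

text \<open>Symmetry makes all complex roots of the characteristic polynomial real, so its real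
  roots exhaust the degree. The list accesses in \<open>fit_cost\<close> are therefore in
  range.\<close>

lemma length_graph_spectrum: "length (graph_spectrum n A) = n"
proof -
  define M where "M = (1 / real n) \<cdot>\<^sub>m A"
  have M: "M \<in> carrier_mat n n" using A by (auto simp: M_def adjacency_matrices_def)
  let ?C = "map_mat complex_of_real M"
  have C: "?C \<in> carrier_mat n n" using M by simp
  have deg: "degree (char_poly M) = n" "char_poly M \<noteq> 0"
    using degree_monic_char_poly[OF M] by auto
  have "z \<in> \<real>" if "poly (map_poly complex_of_real (char_poly M)) z = 0" for z
  proof (rule symmetric_eigenvalue_real[OF C])
    show "eigenvalue ?C z"
      using that eigenvalue_root_char_poly[OF C] by (simp add: of_real_hom.char_poly_hom[OF M])
    show "?C $$ (i,j) = cnj (?C $$ (j,i))" if "i < n" "j < n" for i j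
      using that A M by (auto simp: M_def adjacency_matrices_def)
  qed
  then have "size (proots (char_poly M)) = n" using size_proots_eq_degree[OF deg(2)] deg(1) by simp
  then show ?thesis by (simp add: graph_spectrum_def M_def[symmetric] flip: size_mset)
qed

text \<open>The entries of A / n are at most 1 / n in modulus, so each row sum is at most 1.\<close>

lemma graph_spectrum_bound:
  assumes "k < n"
  shows "\<bar>graph_spectrum n A ! k\<bar> \<le> 1"
proof -
  define M where "M = (1 / real n) \<cdot>\<^sub>m A"
  have M: "M \<in> carrier_mat n n" using A by (auto simp: M_def adjacency_matrices_def)
  have cp: "char_poly M \<noteq> 0" using degree_monic_char_poly[OF M] by auto
  have "graph_spectrum n A ! k \<in> set (graph_spectrum n A)"
    using assms length_graph_spectrum by simp
  then have "poly (char_poly M) (graph_spectrum n A ! k) = 0"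
    using cp by (simp add: graph_spectrum_def M_def[symmetric])
  then have ev: "eigenvalue M (graph_spectrum n A ! k)"
    using eigenvalue_root_char_poly[OF M] by simp
  have "\<bar>M $$ (i,j)\<bar> \<le> 1 / real n" if "i < n" "j < n" for i j
  proof -
    have "A $$ (i,j) \<in> {0,1}" "A \<in> carrier_mat n n"
      using A that by (simp_all add: adjacency_matrices_def)
    then show ?thesis using that by (auto simp: M_def)
  qed
  then have "(\<Sum>j<n. \<bar>M $$ (i,j)\<bar>) \<le> 1" if "i < n" for i
    using sum_bounded_above[of "{..<n}" "\<lambda>j. \<bar>M $$ (i,j)\<bar>" "1 / real n"] that by auto
  from eigenvalue_row_sum_bound[OF M this ev] show ?thesis .
qed

end

subsection \<open>The distance between square-summable sequences\<close>

definition l2_summable :: "(nat \<Rightarrow> real) \<Rightarrow> bool" where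
  "l2_summable x \<longleftrightarrow> summable (\<lambda>i. (x i)\<^sup>2)"

definition l2_norm :: "(nat \<Rightarrow> real) \<Rightarrow> real" where
  "l2_norm x = sqrt (\<Sum>i. (x i)\<^sup>2)"

definition finite_perms :: "(nat \<Rightarrow> nat) set" where
  "finite_perms = {\<pi>. bij \<pi> \<and> finite {i. \<pi> i \<noteq> i}}"

lemma l2_norm_nonneg: "l2_summable x \<Longrightarrow> 0 \<le> l2_norm x"
  unfolding l2_norm_def l2_summable_def by (simp add: suminf_nonneg)

lemma L2_set_le_l2_norm:
  assumes "l2_summable x" "finite A"
  shows "L2_set x A \<le> l2_norm x"
  unfolding L2_set_def l2_norm_def
  using assms by (intro real_sqrt_le_mono sum_le_suminf) (auto simp: l2_summable_def)

text \<open>Bounds on all finite sections pass to the limit; Minkowski's inequality for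
  \<open>L2_set\<close> thereby carries over to sequences.\<close>

lemma l2_boundedI:
  assumes "\<And>n. L2_set x {..<n} \<le> B"
  shows "l2_summable x" "l2_norm x \<le> B"
proof -
  have B: "0 \<le> B" using assms[of 0] by simp
  have le: "(\<Sum>i<n. (x i)\<^sup>2) \<le> B\<^sup>2" for n
    using power_mono[OF assms[of n] L2_set_nonneg, of 2] by (simp add: L2_set_def sum_nonneg)
  show s: "l2_summable x"
    unfolding l2_summable_def by (rule summableI_nonneg_bounded[OF _ le]) simp
  have "(\<Sum>i. (x i)\<^sup>2) \<le> B\<^sup>2"
    using s le unfolding l2_summable_def by (intro suminf_le_const) auto
  then show "l2_norm x \<le> B" unfolding l2_norm_def using B by (simp add: real_le_lsqrt)
qed

lemma l2_add:
  assumes "l2_summable x" "l2_summable y"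
  shows "l2_summable (\<lambda>i. x i + y i)" "l2_norm (\<lambda>i. x i + y i) \<le> l2_norm x + l2_norm y"
proof -
  have "L2_set (\<lambda>i. x i + y i) {..<n} \<le> l2_norm x + l2_norm y" for n
    using L2_set_triangle_ineq[of x y "{..<n}"] L2_set_le_l2_norm[OF assms(1), of "{..<n}"]
      L2_set_le_l2_norm[OF assms(2), of "{..<n}"] by simp
  from l2_boundedI[of "\<lambda>i. x i + y i", OF this]
  show "l2_summable (\<lambda>i. x i + y i)" "l2_norm (\<lambda>i. x i + y i) \<le> l2_norm x + l2_norm y" by auto
qed

lemma l2_minus: "l2_summable (\<lambda>i. - x i) = l2_summable x" "l2_norm (\<lambda>i. - x i) = l2_norm x"
  by (simp_all add: l2_summable_def l2_norm_def)

lemma l2_diff: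
  assumes "l2_summable x" "l2_summable y"
  shows "l2_summable (\<lambda>i. x i - y i)" "l2_norm (\<lambda>i. x i - y i) \<le> l2_norm x + l2_norm y"
  using l2_add[of x "\<lambda>i. - y i"] assms by (simp_all add: l2_minus)

text \<open>A convergent series of nonnegative terms may be rearranged. This invariance underlies
  both the symmetry and the triangle inequality of \<open>\<delta>\<^sub>2\<close>.\<close>

lemma l2_reindex:
  assumes "bij \<pi>" "l2_summable x"
  shows "l2_summable (x \<circ> \<pi>)" "l2_norm (x \<circ> \<pi>) = l2_norm x"
proof -
  have eq: "(\<lambda>i. ((x \<circ> \<pi>) i)\<^sup>2) = (\<lambda>i. (x i)\<^sup>2) \<circ> \<pi>" by auto
  have s: "summable (\<lambda>i. (x i)\<^sup>2)" using assms(2) by (simp add: l2_summable_def)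
  show "l2_summable (x \<circ> \<pi>)"
    unfolding l2_summable_def eq by (rule summable_reindex[OF s bij_is_inj[OF assms(1)]]) simp
  have "suminf ((\<lambda>i. (x i)\<^sup>2) \<circ> \<pi>) = suminf (\<lambda>i. (x i)\<^sup>2)"
    using bij_is_surj[OF assms(1)] by (intro suminf_reindex[OF s bij_is_inj[OF assms(1)]]) auto
  then show "l2_norm (x \<circ> \<pi>) = l2_norm x"
    unfolding l2_norm_def eq by simp
qed

section \<open>Finitely supported permutations and the pseudometric they induce\<close>

lemma finite_perms_comp: "\<pi> \<in> finite_perms \<Longrightarrow> \<sigma> \<in> finite_perms \<Longrightarrow> \<sigma> \<circ> \<pi> \<in> finite_perms"
  unfolding finite_perms_def
  by (auto intro: bij_comp finite_subset[of "{i. \<sigma> (\<pi> i) \<noteq> i}" "{i. \<pi> i \<noteq> i} \<union> {i. \<sigma> i \<noteq> i}"])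

lemma finite_perms_inv:
  assumes "\<pi> \<in> finite_perms"
  shows "inv_into UNIV \<pi> \<in> finite_perms"
proof -
  have b: "bij \<pi>" using assms by (simp add: finite_perms_def)
  have "inv_into UNIV \<pi> i = i \<longleftrightarrow> \<pi> i = i" for i
    using b by (metis bij_inv_eq_iff)
  then show ?thesis using assms b by (simp add: finite_perms_def bij_imp_bij_inv)
qed

lemma delta_eq: "\<delta>\<^sub>2 x y = (INF \<pi>\<in>finite_perms. l2_norm (\<lambda>i. x i - y (\<pi> i)))"
  by (simp add: \<delta>\<^sub>2_def l2_norm_def finite_perms_def)

lemma id_finite_perms: "id \<in> finite_perms" by (simp add: finite_perms_def)

context
  fixes x y :: "nat \<Rightarrow> real"
  assumes x: "l2_summable x" and y: "l2_summable y"
begin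

lemma l2_summable_diff_perm:
  assumes "\<pi> \<in> finite_perms"
  shows "l2_summable (\<lambda>i. x i - y (\<pi> i))"
  using l2_diff(1)[OF x l2_reindex(1)[OF _ y]] assms by (simp add: finite_perms_def)

lemma delta_bdd: "bdd_below ((\<lambda>\<pi>. l2_norm (\<lambda>i. x i - y (\<pi> i))) ` finite_perms)"
  by (rule bdd_belowI2[of _ 0]) (rule l2_norm_nonneg[OF l2_summable_diff_perm])

lemma delta_le: "\<pi> \<in> finite_perms \<Longrightarrow> \<delta>\<^sub>2 x y \<le> l2_norm (\<lambda>i. x i - y (\<pi> i))"
  unfolding delta_eq by (rule cINF_lower[OF delta_bdd])

lemma delta_le_norm: "\<delta>\<^sub>2 x y \<le> l2_norm (\<lambda>i. x i - y i)"
  using delta_le[OF id_finite_perms] by simp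

lemma delta_nonneg: "0 \<le> \<delta>\<^sub>2 x y"
  unfolding delta_eq
  by (rule cINF_greatest) (use id_finite_perms l2_norm_nonneg[OF l2_summable_diff_perm] in auto)

text \<open>The infimum over permutations need not be attained, so later proofs work with
  permutations that are optimal up to an arbitrary slack.\<close>

lemma delta_less:
  assumes "\<delta>\<^sub>2 x y < e"
  obtains \<pi> where "\<pi> \<in> finite_perms" "l2_norm (\<lambda>i. x i - y (\<pi> i)) < e"
proof -
  have ne: "finite_perms \<noteq> {}" using id_finite_perms by auto
  from assms that show ?thesis
    unfolding delta_eq cINF_less_iff[OF ne delta_bdd] by blast
qed

end

lemma delta_self: "l2_summable x \<Longrightarrow> \<delta>\<^sub>2 x x = 0"
  using delta_le_norm[of x x] delta_nonneg[of x x] by (simp add: l2_norm_def)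

text \<open>Two nearly optimal permutations are composed; reindexing the second difference by the
  first permutation preserves its norm.\<close>

lemma delta_triangle:
  assumes x: "l2_summable x" and y: "l2_summable y" and z: "l2_summable z"
  shows "\<delta>\<^sub>2 x z \<le> \<delta>\<^sub>2 x y + \<delta>\<^sub>2 y z"
proof (rule field_le_epsilon)
  fix e :: real assume e: "e > 0"
  obtain \<pi> where \<pi>: "\<pi> \<in> finite_perms" "l2_norm (\<lambda>i. x i - y (\<pi> i)) < \<delta>\<^sub>2 x y + e/2"
    using delta_less[OF x y, of "\<delta>\<^sub>2 x y + e/2"] e by auto
  obtain \<sigma> where \<sigma>: "\<sigma> \<in> finite_perms" "l2_norm (\<lambda>i. y i - z (\<sigma> i)) < \<delta>\<^sub>2 y z + e/2"
    using delta_less[OF y z, of "\<delta>\<^sub>2 y z + e/2"] e by auto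
  have b: "bij \<pi>" "bij \<sigma>" using \<pi> \<sigma> by (auto simp: finite_perms_def)
  have y\<pi>: "l2_summable (\<lambda>i. y (\<pi> i))" using l2_reindex(1)[OF b(1) y] by (simp add: comp_def)
  have z\<sigma>: "l2_summable (\<lambda>i. z (\<sigma> i))" using l2_reindex(1)[OF b(2) z] by (simp add: comp_def)
  have "\<delta>\<^sub>2 x z \<le> l2_norm (\<lambda>i. x i - z (\<sigma> (\<pi> i)))"
    using delta_le[OF x z finite_perms_comp[OF \<pi>(1) \<sigma>(1)]] by simp
  also have "\<dots> = l2_norm (\<lambda>i. (x i - y (\<pi> i)) + ((\<lambda>i. y i - z (\<sigma> i)) \<circ> \<pi>) i)"
    by simp
  also have "\<dots> \<le> l2_norm (\<lambda>i. x i - y (\<pi> i)) + l2_norm ((\<lambda>i. y i - z (\<sigma> i)) \<circ> \<pi>)"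
    by (intro l2_add l2_diff x y\<pi> l2_reindex(1) b y z\<sigma>)
  also have "l2_norm ((\<lambda>i. y i - z (\<sigma> i)) \<circ> \<pi>) = l2_norm (\<lambda>i. y i - z (\<sigma> i))"
    by (intro l2_reindex b l2_diff y z\<sigma>)
  finally show "\<delta>\<^sub>2 x z \<le> \<delta>\<^sub>2 x y + \<delta>\<^sub>2 y z + e" using \<pi> \<sigma> by simp
qed

text \<open>The inverse of a nearly optimal permutation is nearly optimal for the swapped
  pair.\<close>

lemma delta_commute_le:
  assumes x: "l2_summable x" and y: "l2_summable y"
  shows "\<delta>\<^sub>2 y x \<le> \<delta>\<^sub>2 x y"
proof (rule field_le_epsilon)
  fix e :: real assume e: "e > 0"
  obtain \<pi> where \<pi>: "\<pi> \<in> finite_perms" "l2_norm (\<lambda>i. x i - y (\<pi> i)) < \<delta>\<^sub>2 x y + e"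
    using delta_less[OF x y, of "\<delta>\<^sub>2 x y + e"] e by auto
  have b: "bij \<pi>" using \<pi> by (auto simp: finite_perms_def)
  have y\<pi>: "l2_summable (\<lambda>i. y (\<pi> i))" using l2_reindex(1)[OF b y] by (simp add: comp_def)
  have "\<delta>\<^sub>2 y x \<le> l2_norm (\<lambda>i. y i - x (inv_into UNIV \<pi> i))"
    by (rule delta_le[OF y x finite_perms_inv[OF \<pi>(1)]])
  also have "\<dots> = l2_norm (\<lambda>i. - ((\<lambda>i. x i - y (\<pi> i)) \<circ> inv_into UNIV \<pi>) i)"
    using b by (simp add: bij_is_surj surj_f_inv_f)
  also have "\<dots> = l2_norm ((\<lambda>i. x i - y (\<pi> i)) \<circ> inv_into UNIV \<pi>)"
    by (rule l2_minus)
  also have "\<dots> = l2_norm (\<lambda>i. x i - y (\<pi> i))"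
    by (intro l2_reindex bij_imp_bij_inv b l2_diff x y\<pi>)
  finally show "\<delta>\<^sub>2 y x \<le> \<delta>\<^sub>2 x y + e" using \<pi> by simp
qed

lemma delta_commute:
  assumes "l2_summable x" "l2_summable y"
  shows "\<delta>\<^sub>2 x y = \<delta>\<^sub>2 y x"
  using delta_commute_le assms by (meson antisym)

subsection \<open>Dimensions of spaces of harmonics\<close>

context
  fixes d :: nat
  assumes d: "d \<ge> 3"
begin

text \<open>Pascal's rule applied twice writes the right side as the left one plus other terms, one
  of them positive. Hence the natural-number subtraction in \<open>harm_dim\<close> is not truncated
  and its value is positive.\<close>

lemma binomial_shift_less: "(l + d - 1 choose l) < (l + d + 1 choose (l + 2))"
proof -
  obtain e where e: "d = Suc (Suc (Suc e))" using d by (metis add_2_eq_Suc le_Suc_ex numeral_3_eq_3 add_Suc)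
  have "0 < (l + e + 2 choose (Suc l))" by simp
  then show ?thesis unfolding e by simp
qed

lemma harm_dim_Suc_Suc:
  "harm_dim d (Suc (Suc l)) = (l + d + 1 choose (l + 2)) - (l + d - 1 choose l)"
  using d by (simp add: harm_dim_def)

lemma harm_dim_pos: "harm_dim d l \<ge> 1"
proof (cases l)
  case (Suc k)
  show ?thesis
  proof (cases k)
    case 0
    then show ?thesis using Suc d by (simp add: harm_dim_def)
  next
    case (Suc m)
    then show ?thesis using \<open>l = Suc k\<close> binomial_shift_less[of m] harm_dim_Suc_Suc[of m] by simp
  qed
qed (simp add: harm_dim_def)

lemma cum_dim_0: "cum_dim d 0 = 1" by (simp add: cum_dim_def harm_dim_def)

lemma cum_dim_Suc: "cum_dim d (Suc R) = cum_dim d R + harm_dim d (Suc R)"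
  by (simp add: cum_dim_def)

text \<open>Each \<open>harm_dim\<close> is a difference of binomials two degrees apart, so the sum
  telescopes to its last two terms.\<close>

lemma cum_dim_eq: "cum_dim d (Suc R) = (R + d choose Suc R) + (R + d - 1 choose R)"
proof (induction R)
  case 0
  then show ?case using d by (simp add: cum_dim_Suc cum_dim_0 harm_dim_def)
next
  case (Suc R)
  have "(Suc R + d choose Suc (Suc R)) = (R + d + 1 choose (R + 2))" by simp
  moreover have "(Suc R + d - 1 choose Suc R) = (R + d choose Suc R)" by simp
  ultimately show ?case
    using Suc binomial_shift_less[of R] unfolding cum_dim_Suc[of "Suc R"] harm_dim_Suc_Suc by linarith
qed

lemma strict_mono_cum_dim: "strict_mono (cum_dim d)"
  using harm_dim_pos by (intro strict_mono_Suc_iff[THEN iffD2]) (simp add: cum_dim_Suc Suc_le_eq)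

lemma cum_dim_gt: "R < cum_dim d R"
proof (induction R)
  case (Suc R)
  then show ?case using harm_dim_pos[of "Suc R"] by (simp add: cum_dim_Suc)
qed (simp add: cum_dim_0)

text \<open>The exponent d - 1, the dimension of the sphere, is the one that enters the
  rate.\<close>

lemma cum_dim_bound:
  assumes "R \<ge> 1"
  shows "real (cum_dim d R) \<le> 2 * real d ^ (d - 1) * real R ^ (d - 1)"
proof -
  obtain k where k: "R = Suc k" using assms by (cases R) auto
  have 1: "(k + d choose Suc k) \<le> (d * R) ^ (d - 1)"
  proof -
    have "(k + d choose Suc k) = (k + d choose (d - 1))"
      using binomial_symmetric[of "Suc k" "k + d"] d by simp
    also have "\<dots> \<le> (k + d) ^ (d - 1)" by (rule binomial_le_pow) (use d in simp)
    \<comment> \<open>Since k + 1 = R, the difference of the two sides is (R - 1) (d - 1).\<close>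
    also have "k + d \<le> d * R" unfolding k using d by simp
    finally show ?thesis by (simp add: power_mono)
  qed
  have 2: "(k + d - 1 choose k) \<le> (k + d choose Suc k)"
  proof -
    have "k + d = Suc (k + d - 1)" using d by simp
    then have "(k + d choose Suc k) = (k + d - 1 choose k) + (k + d - 1 choose Suc k)"
      by (metis binomial_Suc_Suc)
    then show ?thesis by simp
  qed
  have "cum_dim d R \<le> 2 * (d * R) ^ (d - 1)"
    unfolding k cum_dim_eq using 1[unfolded k] 2 by linarith
  then have "real (cum_dim d R) \<le> real (2 * (d * R) ^ (d - 1))" by (simp only: of_nat_le_iff)
  then show ?thesis by (simp add: power_mult_distrib)
qed

section \<open>Positions in the spectrum and degrees of harmonics\<close>

lemma degree_at_le_iff: "degree_at d k \<le> R \<longleftrightarrow> k < cum_dim d R"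
proof
  assume "degree_at d k \<le> R"
  moreover have "k < cum_dim d (degree_at d k)"
    unfolding degree_at_def by (rule LeastI[of _ k]) (rule cum_dim_gt)
  ultimately show "k < cum_dim d R"
    using strict_mono_less_eq[OF strict_mono_cum_dim] by (meson less_le_trans)
qed (simp add: degree_at_def Least_le)

text \<open>The positions of degree l form a block of length \<open>harm_dim d l\<close>, which
  turns sums over positions into weighted sums over degrees.\<close>

lemma sum_degree_at:
  fixes g :: "nat \<Rightarrow> real"
  shows "(\<Sum>k<cum_dim d R. g (degree_at d k)) = (\<Sum>l\<le>R. real (harm_dim d l) * g l)"
proof (induction R)
  case 0
  have "degree_at d 0 = 0" using degree_at_le_iff[of 0 0] by (simp add: cum_dim_0)
  then show ?case by (simp add: cum_dim_0 harm_dim_def)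
next
  case (Suc R)
  have "(\<Sum>k<cum_dim d (Suc R). g (degree_at d k)) =
      (\<Sum>k<cum_dim d R. g (degree_at d k)) + (\<Sum>k=cum_dim d R..<cum_dim d (Suc R). g (degree_at d k))"
    by (simp add: lessThan_atLeast0 sum.atLeastLessThan_concat cum_dim_Suc)
  also have "(\<Sum>k=cum_dim d R..<cum_dim d (Suc R). g (degree_at d k)) =
      (\<Sum>k=cum_dim d R..<cum_dim d (Suc R). g (Suc R))"
  proof (rule sum.cong[OF refl])
    fix k assume "k \<in> {cum_dim d R..<cum_dim d (Suc R)}"
    then have "degree_at d k \<le> Suc R" "\<not> degree_at d k \<le> R"
      unfolding degree_at_le_iff by auto
    then show "g (degree_at d k) = g (Suc R)" by (metis le_SucE)
  qed
  also have "\<dots> = real (harm_dim d (Suc R)) * g (Suc R)" by (simp add: cum_dim_Suc)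
  finally show ?case using Suc by simp
qed

text \<open>The first n positions lie within the complete blocks up to degree n.\<close>

lemma sum_degree_at_le:
  fixes g :: "nat \<Rightarrow> real"
  assumes "\<And>l. 0 \<le> g l" and "summable (\<lambda>l. real (harm_dim d l) * g l)"
  shows "(\<Sum>k<n. g (degree_at d k)) \<le> (\<Sum>l. real (harm_dim d l) * g l)"
proof -
  have "(\<Sum>k<n. g (degree_at d k)) \<le> (\<Sum>k<cum_dim d n. g (degree_at d k))"
    using cum_dim_gt[of n] assms(1) by (intro sum_mono2) auto
  also have "\<dots> \<le> (\<Sum>l. real (harm_dim d l) * g l)"
    unfolding sum_degree_at using assms by (intro sum_le_suminf) auto
  finally show ?thesis .
qed

end

subsection \<open>Bias and adaptation\<close>

context
  fixes d :: nat and s :: real and p :: "real \<Rightarrow> real"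
  assumes d: "d \<ge> 3" and s: "s > 0" and p: "p \<in> sobolev_space d s"
begin

lemma sobolev_term_nonneg: "0 \<le> sobolev_term d s p l"
  by (simp add: sobolev_term_def add_nonneg_nonneg)

lemma summable_sobolev_term: "summable (sobolev_term d s p)"
  using p by (simp add: sobolev_space_def)

lemma sobolev_norm_nonneg: "0 \<le> sobolev_norm d s p"
  unfolding sobolev_norm_def
  using suminf_nonneg[OF summable_sobolev_term sobolev_term_nonneg] by simp

lemma sobolev_norm_square: "(sobolev_norm d s p)\<^sup>2 = (\<Sum>l. sobolev_term d s p l)"
  unfolding sobolev_norm_def
  using suminf_nonneg[OF summable_sobolev_term sobolev_term_nonneg] by simp

lemma coeff_le_sobolev_term: "real (harm_dim d l) * (geg_coeff d p l)\<^sup>2 \<le> sobolev_term d s p l"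
  using mult_left_mono[of 1 "1 + (real l * (real l + 2 * geg_index d)) powr s"
      "real (harm_dim d l) * (geg_coeff d p l)\<^sup>2"]
  by (simp add: sobolev_term_def)

text \<open>Beyond degree R the Sobolev weight is at least the power 2 s of R.\<close>

lemma tail_coeff_le_sobolev_term:
  assumes "R \<ge> 1" "R < l"
  shows "real (harm_dim d l) * (geg_coeff d p l)\<^sup>2 \<le> sobolev_term d s p l * (real R powr (- s))\<^sup>2"
proof -
  have "0 \<le> geg_index d" using d by (simp add: geg_index_def)
  then have "real R * real R \<le> real l * (real l + 2 * geg_index d)"
    using assms by (intro mult_mono) auto
  then have "(real R * real R) powr s \<le> (real l * (real l + 2 * geg_index d)) powr s"
    using s by (intro powr_mono2) auto
  then have "1 \<le> (1 + (real l * (real l + 2 * geg_index d)) powr s) * (real R powr (- s))\<^sup>2"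
    using assms by (simp add: powr_mult powr_minus field_simps power2_eq_square)
  then have "real (harm_dim d l) * (geg_coeff d p l)\<^sup>2 * 1 \<le> real (harm_dim d l) * (geg_coeff d p l)\<^sup>2 *
      ((1 + (real l * (real l + 2 * geg_index d)) powr s) * (real R powr (- s))\<^sup>2)"
    by (intro mult_left_mono) auto
  then show ?thesis by (simp add: sobolev_term_def mult_ac)
qed

text \<open>Both the full spectrum and its tails are of the form \<open>x k = h (degree_at d k)\<close>.\<close>

lemma l2_of_degree:
  assumes "\<And>l. real (harm_dim d l) * (h l)\<^sup>2 \<le> sobolev_term d s p l * B\<^sup>2" and "B \<ge> 0"
  shows "l2_summable (\<lambda>k. h (degree_at d k))"
    and "l2_norm (\<lambda>k. h (degree_at d k)) \<le> sobolev_norm d s p * B"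
proof -
  have sm: "summable (\<lambda>l. sobolev_term d s p l * B\<^sup>2)"
    by (rule summable_mult2[OF summable_sobolev_term])
  then have sh: "summable (\<lambda>l. real (harm_dim d l) * (h l)\<^sup>2)"
    by (rule summable_comparison_test') (use assms(1) in \<open>auto simp: abs_mult\<close>)
  have "L2_set (\<lambda>k. h (degree_at d k)) {..<n} \<le> sobolev_norm d s p * B" for n
  proof -
    have "(\<Sum>k<n. (h (degree_at d k))\<^sup>2) \<le> (\<Sum>l. real (harm_dim d l) * (h l)\<^sup>2)"
      using sum_degree_at_le[OF d, of "\<lambda>l. (h l)\<^sup>2"] sh by simp
    also have "\<dots> \<le> (\<Sum>l. sobolev_term d s p l * B\<^sup>2)"
      by (rule suminf_le[OF assms(1) sh sm])
    also have "\<dots> = (sobolev_norm d s p * B)\<^sup>2"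
      by (simp add: power_mult_distrib sobolev_norm_square suminf_mult2[OF summable_sobolev_term])
    finally show ?thesis
      unfolding L2_set_def using sobolev_norm_nonneg assms(2) by (intro real_le_lsqrt) auto
  qed
  from l2_boundedI[OF this] show "l2_summable (\<lambda>k. h (degree_at d k))"
    and "l2_norm (\<lambda>k. h (degree_at d k)) \<le> sobolev_norm d s p * B" by auto
qed

lemma lambda_star_l2:
  shows "l2_summable (lambda_star d p)" and "l2_norm (lambda_star d p) \<le> sobolev_norm d s p"
  using l2_of_degree[of "geg_coeff d p" 1] coeff_le_sobolev_term
  by (simp_all add: lambda_star_def[abs_def])

lemma lambda_star_trunc_eq:
  "lambda_star_trunc d p R k = (if degree_at d k \<le> R then geg_coeff d p (degree_at d k) else 0)"
  using degree_at_le_iff[OF d] by (simp add: lambda_star_trunc_def block_vector_def)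

lemma lambda_star_trunc_l2: "l2_summable (lambda_star_trunc d p R)"
proof -
  have "l2_summable (\<lambda>k. (\<lambda>l. if l \<le> R then geg_coeff d p l else 0) (degree_at d k))"
    by (rule l2_of_degree(1)[of _ 1]) (auto simp: coeff_le_sobolev_term sobolev_term_nonneg)
  then show ?thesis by (simp add: lambda_star_trunc_eq[abs_def])
qed

text \<open>The identity permutation suffices: both differences vanish up to degree R, so the tail
  estimate applies.\<close>

lemma delta_trunc_le:
  assumes "R \<ge> 1" "R \<le> R'"
  shows "\<delta>\<^sub>2 (lambda_star_trunc d p R') (lambda_star d p) \<le> sobolev_norm d s p * real R powr (- s)"
    and "\<delta>\<^sub>2 (lambda_star_trunc d p R') (lambda_star_trunc d p R) \<le> sobolev_norm d s p * real R powr (- s)"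
proof -
  let ?h = "\<lambda>l. if l \<le> R' then 0 else - geg_coeff d p l"
  let ?g = "\<lambda>l. if l \<le> R \<or> R' < l then 0 else geg_coeff d p l"
  have tail: "sobolev_term d s p l * (real R powr (- s))\<^sup>2 \<ge> 0" for l
    using sobolev_term_nonneg by simp
  have "l2_norm (\<lambda>k. ?h (degree_at d k)) \<le> sobolev_norm d s p * real R powr (- s)"
    using assms tail by (intro l2_of_degree) (auto intro: tail_coeff_le_sobolev_term)
  moreover have "(\<lambda>k. lambda_star_trunc d p R' k - lambda_star d p k) = (\<lambda>k. ?h (degree_at d k))"
    by (auto simp: lambda_star_trunc_eq lambda_star_def)
  ultimately show "\<delta>\<^sub>2 (lambda_star_trunc d p R') (lambda_star d p) \<le> sobolev_norm d s p * real R powr (- s)"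
    using delta_le_norm[OF lambda_star_trunc_l2 lambda_star_l2(1), of R'] by simp
  have "l2_norm (\<lambda>k. ?g (degree_at d k)) \<le> sobolev_norm d s p * real R powr (- s)"
    using assms tail by (intro l2_of_degree) (auto intro: tail_coeff_le_sobolev_term)
  moreover have "(\<lambda>k. lambda_star_trunc d p R' k - lambda_star_trunc d p R k) = (\<lambda>k. ?g (degree_at d k))"
    using assms by (auto simp: lambda_star_trunc_eq)
  ultimately show "\<delta>\<^sub>2 (lambda_star_trunc d p R') (lambda_star_trunc d p R) \<le> sobolev_norm d s p * real R powr (- s)"
    using delta_le_norm[OF lambda_star_trunc_l2 lambda_star_trunc_l2, of R' R] by simp
qed

end

section \<open>A priori bound on the estimates\<close>

text \<open>The zero vector is a competitor of cost at most n, because the eigenvalues lie in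
  [-1, 1]. The minimiser is thus within sqrt n of a list of eigenvalues whose own norm is at most
  sqrt n.\<close>

lemma estimate_l2:
  assumes est: "is_estimate d n R A u" and A: "A \<in> adjacency_matrices n" and n: "cum_dim d R \<le> n"
  shows "l2_summable u" and "l2_norm u \<le> 2 * sqrt (real n)"
proof -
  let ?lam = "graph_spectrum n A" and ?m = "cum_dim d R"
  let ?c = "\<lambda>u \<tau>. (\<Sum>k<?m. (u k - ?lam ! \<tau> k)\<^sup>2) + (\<Sum>k=?m..<n. (?lam ! \<tau> k)\<^sup>2)"
  let ?P = "{\<tau>. \<tau> permutes {..<n}}"
  have fin: "finite ?P" "?P \<noteq> {}" using finite_permutations[of "{..<n}"] permutes_id[of "{..<n}"] by blast+
  have lam: "(\<Sum>k<?m. (?lam ! \<tau> k)\<^sup>2) + (\<Sum>k=?m..<n. (?lam ! \<tau> k)\<^sup>2) \<le> real n" if "\<tau> \<in> ?P" for \<tau>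
  proof -
    have "(\<Sum>k<?m. (?lam ! \<tau> k)\<^sup>2) + (\<Sum>k=?m..<n. (?lam ! \<tau> k)\<^sup>2) = (\<Sum>k<n. (?lam ! \<tau> k)\<^sup>2)"
      using n by (simp add: lessThan_atLeast0 sum.atLeastLessThan_concat)
    also have "\<dots> \<le> (\<Sum>k<n. 1)"
    proof (rule sum_mono)
      fix k assume "k \<in> {..<n}"
      then have "\<tau> k < n" using that permutes_in_image[of \<tau> "{..<n}" k] by simp
      from graph_spectrum_bound[OF A this] show "(?lam ! \<tau> k)\<^sup>2 \<le> 1"
        by (simp add: abs_square_le_1)
    qed
    finally show ?thesis by simp
  qed
  obtain v where u: "u = block_vector d R v"
    using est by (auto simp: is_estimate_def is_arg_min_def model_space_def)
  have supp: "u k = 0" if "k \<ge> ?m" for k using that by (simp add: u block_vector_def)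
  have "(\<lambda>_. 0) \<in> model_space d R"
    unfolding model_space_def by (rule range_eqI[of _ _ "\<lambda>_. 0"]) (auto simp: block_vector_def)
  then have "fit_cost d n R ?lam u \<le> fit_cost d n R ?lam (\<lambda>_. 0)"
    using est by (auto simp: is_estimate_def is_arg_min_def not_less)
  also have "\<dots> \<le> ?c (\<lambda>_. 0) id"
    unfolding fit_cost_def
    by (rule Min_le[OF finite_imageI[OF fin(1)]])
      (rule image_eqI[where x = id], use permutes_id in auto)
  also have "\<dots> \<le> real n" using lam[of id] permutes_id by simp
  finally have "fit_cost d n R ?lam u \<le> real n" .
  moreover have "fit_cost d n R ?lam u \<in> ?c u ` ?P"
    unfolding fit_cost_def using fin by (intro Min_in) auto
  ultimately obtain \<tau> where \<tau>: "\<tau> \<in> ?P" "?c u \<tau> \<le> real n" by auto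
  have "(\<Sum>k<?m. (u k)\<^sup>2) \<le> (\<Sum>k<?m. 2 * (u k - ?lam ! \<tau> k)\<^sup>2 + 2 * (?lam ! \<tau> k)\<^sup>2)"
  proof (rule sum_mono)
    fix k
    \<comment> \<open>This square is exactly the right side minus the left side of the
      claim.\<close>
    have "0 \<le> (u k - 2 * ?lam ! \<tau> k)\<^sup>2" by simp
    then show "(u k)\<^sup>2 \<le> 2 * (u k - ?lam ! \<tau> k)\<^sup>2 + 2 * (?lam ! \<tau> k)\<^sup>2"
      by (simp add: power2_eq_square algebra_simps)
  qed
  also have "\<dots> = 2 * (\<Sum>k<?m. (u k - ?lam ! \<tau> k)\<^sup>2) + 2 * (\<Sum>k<?m. (?lam ! \<tau> k)\<^sup>2)"
    by (simp add: sum.distrib sum_distrib_left)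
  also have "\<dots> \<le> 4 * real n"
  proof -
    have "0 \<le> (\<Sum>k=?m..<n. (?lam ! \<tau> k)\<^sup>2)" by (simp add: sum_nonneg)
    then show ?thesis using lam[OF \<tau>(1)] \<tau>(2) by linarith
  qed
  finally have bound: "(\<Sum>k<?m. (u k)\<^sup>2) \<le> (2 * sqrt (real n))\<^sup>2" by (simp add: power_mult_distrib)
  have "L2_set u {..<N} \<le> 2 * sqrt (real n)" for N
  proof -
    have "(\<Sum>k<N. (u k)\<^sup>2) \<le> (\<Sum>k<?m. (u k)\<^sup>2)"
    proof -
      have "(\<Sum>k<N. (u k)\<^sup>2) \<le> (\<Sum>k<max N ?m. (u k)\<^sup>2)" by (intro sum_mono2) auto
      also have "\<dots> = (\<Sum>k<?m. (u k)\<^sup>2)" using supp by (intro sum.mono_neutral_right) auto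
      finally show ?thesis .
    qed
    then have "(\<Sum>k<N. (u k)\<^sup>2) \<le> (2 * sqrt (real n))\<^sup>2" using bound by simp
    then show ?thesis unfolding L2_set_def by (intro real_le_lsqrt) auto
  qed
  from l2_boundedI[OF this] show "l2_summable u" "l2_norm u \<le> 2 * sqrt (real n)" by auto
qed

section \<open>The Goldenshluger-Lepski comparison\<close>

text \<open>The path runs from \<open>est Rhat\<close> through \<open>est (min Rhat R)\<close>,
  \<open>est R\<close> and \<open>X R\<close> to \<open>x\<close>. The criterion controls the first
  two legs, the good event the third and the bias the last.\<close>

lemma adaptive_oracle_bound:
  assumes adaptive: "is_adaptive_resolution d n \<kappa> Rmax est Rhat"
    and \<kappa>: "\<kappa> > 0" and n: "n \<ge> 1" and R: "R \<in> {1..Rmax}"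
    and est: "\<And>R. R \<in> {1..Rmax} \<Longrightarrow> l2_summable (est R)"
    and target: "l2_summable x" "\<And>R. l2_summable (X R)"
    and approx: "\<And>R'. R \<le> R' \<Longrightarrow> \<delta>\<^sub>2 (X R') x \<le> t" "\<And>R'. R \<le> R' \<Longrightarrow> \<delta>\<^sub>2 (X R') (X R) \<le> t"
    and good: "\<And>R'. R' \<in> {1..Rmax} \<Longrightarrow> \<delta>\<^sub>2 (est R') (X R') \<le> 4 * \<delta>\<^sub>2 (X R') x + penalty d n \<kappa> R'"
  shows "\<delta>\<^sub>2 (est Rhat) x \<le> 23 * t + 5 * penalty d n \<kappa> R"
proof -
  let ?B = "adaptive_B d n \<kappa> Rmax est" and ?pen = "penalty d n \<kappa>"
  have Rhat: "Rhat \<in> {1..Rmax}" and opt: "?B Rhat + ?pen Rhat \<le> ?B R + ?pen R"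
    using adaptive R by (auto simp: is_adaptive_resolution_def is_arg_min_def not_less)
  have pen: "0 \<le> ?pen R'" for R' using \<kappa> n by (simp add: penalty_def)
  have t: "0 \<le> t" using approx(1)[of R] delta_nonneg[OF target(2,1), of R] by simp
  have B: "\<delta>\<^sub>2 (est R') (est (min R' R'')) - ?pen R' \<le> ?B R''" if "R' \<in> {1..Rmax}" for R' R''
    unfolding adaptive_B_def using that by (intro Max_ge) auto
  have gd: "\<delta>\<^sub>2 (est R') (X R') \<le> 4 * t + ?pen R'" if "R' \<in> {1..Rmax}" "R \<le> R'" for R'
    using good[OF that(1)] approx(1)[OF that(2)] by simp
  \<comment> \<open>For R' > R, going through \<open>X R'\<close> and \<open>X R\<close> costs 4 t,
    t and 4 t plus two penalties; subtracting the penalty of R' leaves that of R. For R' at most R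
    the estimates coincide.\<close>
  have "?B R \<le> 9 * t + ?pen R"
    unfolding adaptive_B_def
  proof (rule Max.boundedI)
    fix b assume "b \<in> (\<lambda>R'. \<delta>\<^sub>2 (est R') (est (min R' R)) - ?pen R') ` {1..Rmax}"
    then obtain R' where R': "R' \<in> {1..Rmax}" "b = \<delta>\<^sub>2 (est R') (est (min R' R)) - ?pen R'" by auto
    show "b \<le> 9 * t + ?pen R"
    proof (cases "R' \<le> R")
      case True
      then show ?thesis using R' delta_self[OF est[OF R'(1)]] pen[of R'] pen[of R] t
        by (simp add: min_absorb1)
    next
      case False
      have "\<delta>\<^sub>2 (est R') (est R) \<le> \<delta>\<^sub>2 (est R') (X R') + \<delta>\<^sub>2 (X R') (est R)"
        by (intro delta_triangle est target R R')
      also have "\<delta>\<^sub>2 (X R') (est R) \<le> \<delta>\<^sub>2 (X R') (X R) + \<delta>\<^sub>2 (X R) (est R)"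
        by (intro delta_triangle est target R R')
      also have "\<delta>\<^sub>2 (X R) (est R) = \<delta>\<^sub>2 (est R) (X R)"
        by (intro delta_commute est target R)
      finally show ?thesis
        using gd[OF R'(1)] gd[OF R] approx(2)[of R'] False R'(2) by (simp add: min_absorb2)
    qed
  qed (use R in auto)
  moreover have "\<delta>\<^sub>2 (est Rhat) (est (min Rhat R)) \<le> ?B R + ?pen Rhat" using B[OF Rhat, of R] by simp
  \<comment> \<open>The previous leg is the term R' = Rhat of \<open>?B R\<close>; this one is the
    term R' = R of \<open>?B Rhat\<close>. Using the minimum makes both available whichever of the
    two resolutions is larger.\<close>
  moreover have "\<delta>\<^sub>2 (est (min Rhat R)) (est R) \<le> ?B Rhat + ?pen R"
  proof -
    have "min Rhat R \<in> {1..Rmax}" using Rhat R by (auto simp: min_def)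
    then have "\<delta>\<^sub>2 (est (min Rhat R)) (est R) = \<delta>\<^sub>2 (est R) (est (min R Rhat))"
      using delta_commute[OF est est[OF R]] by (simp add: min.commute)
    then show ?thesis using B[OF R, of Rhat] by simp
  qed
  moreover have "\<delta>\<^sub>2 (est Rhat) x \<le>
      \<delta>\<^sub>2 (est Rhat) (est (min Rhat R)) + (\<delta>\<^sub>2 (est (min Rhat R)) (est R) + (\<delta>\<^sub>2 (est R) (X R) + \<delta>\<^sub>2 (X R) x))"
  proof -
    have m: "min Rhat R \<in> {1..Rmax}" using Rhat R by (auto simp: min_def)
    note tr = delta_triangle
    show ?thesis
      using tr[OF est[OF Rhat] est[OF m] target(1)] tr[OF est[OF m] est[OF R] target(1)]
        tr[OF est[OF R] target(2)[of R] target(1)] by linarith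
  qed
  \<comment> \<open>By optimality of Rhat the first two legs cost at most twice
    \<open>?B R + ?pen R\<close>, that is 18 t plus four penalties; the last two add 5 t and one
    penalty.\<close>
  ultimately show ?thesis using opt gd[OF R] approx(1)[of R] by simp
qed

subsection \<open>Risk of the adaptive estimator\<close>

text \<open>
  The level \<open>\<alpha> = n\<^sup>-\<^sup>3\<close> is the smallest integer power of \<open>n\<close> with \<open>1 + ln (D / \<alpha>) \<le> 5 ln n\<close> whenever
  \<open>2 D \<le> n\<close>; this is where \<open>\<kappa> \<ge> \<kappa>\<^sub>0 sqrt 5\<close> comes from.
\<close>

lemma concentration_at_resolution:
  fixes n R :: nat
  assumes dim: "d = CARD('d::finite)" and d: "d \<ge> 3" and conc: "concentration_constant TYPE('d) \<kappa>\<^sub>0"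
    and \<kappa>: "\<kappa> > 0" "\<kappa> \<ge> \<kappa>\<^sub>0 * sqrt 5"
    and p: "envelope p" and n: "2 * cum_dim d R \<le> n"
    and est: "\<And>A. A \<in> adjacency_matrices n \<Longrightarrow> is_estimate d n R A (est A)"
  shows "measure (graph_law TYPE('d) p n)
     {A. \<not> \<delta>\<^sub>2 (est A) (lambda_star_trunc d p R)
         \<le> 4 * \<delta>\<^sub>2 (lambda_star_trunc d p R) (lambda_star d p) + penalty d n \<kappa> R} \<le> 3 / real n ^ 3"
proof -
  interpret G: prob_space "graph_law TYPE('d) p n" by (rule prob_space_graph_law[OF p])
  have [simp]: "space (graph_law TYPE('d) p n) = UNIV"
    using sets_graph_law[OF p] sets.top sets.sets_into_space by (metis UNIV_I top.extremum_uniqueI)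
  note [simp] = sets_graph_law[OF p]
  define D where "D = real (cum_dim d R)"
  have "1 \<le> cum_dim d R" using cum_dim_gt[OF d, of R] by simp
  then have D: "1 \<le> D" "2 * D \<le> real n" unfolding D_def using n by linarith+
  then have n2: "real n \<ge> 2" by simp
  define \<alpha> where "\<alpha> = 1 / real n ^ 3"
  have \<alpha>: "0 < \<alpha>" "\<alpha> < 1" unfolding \<alpha>_def using n2 one_less_power[of "real n" 3] by simp_all
  have ln0: "0 < ln (real n)" using n2 by simp
  have lnD: "ln (2 * D / \<alpha>) \<le> 4 * ln (real n)"
  proof -
    have "ln (2 * D / \<alpha>) = ln (2 * D) + 3 * ln (real n)"
      using D n2 by (simp add: \<alpha>_def ln_mult ln_realpow)
    moreover have "ln (2 * D) \<le> ln (real n)" using D by simp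
    ultimately show ?thesis by simp
  qed
  \<comment> \<open>The sample-size condition of \<open>concentration_constant\<close> at this
    \<alpha>: with D at most n / 2 and ln n at most n, the left side is at most twice the square of
    n.\<close>
  have c1: "D * ln (2 * D / \<alpha>) \<le> real n ^ 3"
  proof -
    have "D * ln (2 * D / \<alpha>) \<le> (real n / 2) * (4 * ln (real n))"
    proof (rule mult_mono[OF _ lnD])
      have "1 \<le> 2 * D / \<alpha>" using D \<alpha> by (simp add: field_simps)
      then show "0 \<le> ln (2 * D / \<alpha>)" by simp
    qed (use D in auto)
    also have "\<dots> \<le> (real n / 2) * (4 * real n)"
      using ln_bound[of "real n"] n2 by (intro mult_left_mono) auto
    also have "\<dots> = 2 * real n ^ 2" by (simp add: power2_eq_square)
    also have "\<dots> \<le> real n * real n ^ 2" using n2 by (intro mult_right_mono) auto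
    finally show ?thesis by (simp add: power3_eq_cube power2_eq_square)
  qed
  have c2: "(2 * D) ^ 3 \<le> real n ^ 3" using D by (intro power_mono) auto
  have "1 - 3 * \<alpha> < measure (graph_law TYPE('d) p n)
     {A. \<delta>\<^sub>2 (est A) (lambda_star_trunc d p R)
         \<le> 4 * \<delta>\<^sub>2 (lambda_star_trunc d p R) (lambda_star d p)
           + \<kappa>\<^sub>0 * sqrt (D * (1 + ln (D / \<alpha>)) / real n)}" (is "_ < measure _ ?S0")
    using conc c1 c2 p \<alpha> est unfolding concentration_constant_def Let_def dim[symmetric] D_def by simp
  moreover have "\<kappa>\<^sub>0 * sqrt (D * (1 + ln (D / \<alpha>)) / real n) \<le> penalty d n \<kappa> R"
  proof (cases "\<kappa>\<^sub>0 \<ge> 0")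
    case True
    have "1 + ln (D / \<alpha>) \<le> 5 * ln (real n)"
    proof -
      have "ln (2 * D / \<alpha>) = ln 2 + ln (D / \<alpha>)"
        using D \<alpha> ln_mult[of 2 "D / \<alpha>"] by simp
      moreover have "ln 2 \<le> ln (real n)" using n2 by simp
      \<comment> \<open>As 1 - ln 2 is at most ln 2, hence at most ln n, the constant 1 is absorbed
        by the fifth logarithm.\<close>
      moreover have "1 / 2 \<le> ln (2::real)" using ln_le_minus_one[of "1 / 2 :: real"] by (simp add: ln_div)
      ultimately show ?thesis using lnD by linarith
    qed
    then have "\<kappa>\<^sub>0 * sqrt (D * (1 + ln (D / \<alpha>)) / real n) \<le> \<kappa>\<^sub>0 * sqrt (D * (5 * ln (real n)) / real n)"
      using True D by (intro mult_left_mono real_sqrt_le_mono divide_right_mono) auto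
    also have "\<dots> = (\<kappa>\<^sub>0 * sqrt 5) * sqrt (D * ln (real n) / real n)"
      by (simp add: real_sqrt_mult real_sqrt_divide)
    also have "\<dots> \<le> \<kappa> * sqrt (D * ln (real n) / real n)"
      using \<kappa> D ln0 by (intro mult_right_mono) auto
    finally show ?thesis by (simp add: penalty_def D_def)
  next
    \<comment> \<open>A negative \<open>\<kappa>\<^sub>0\<close> makes the deviation term
      nonpositive, while the penalty is nonnegative.\<close>
    case False
    have "1 \<le> D / \<alpha>" using D \<alpha> by (simp add: field_simps)
    then have "0 \<le> sqrt (D * (1 + ln (D / \<alpha>)) / real n)" using D by simp
    then have "\<kappa>\<^sub>0 * sqrt (D * (1 + ln (D / \<alpha>)) / real n) \<le> 0"
      using False by (intro mult_nonpos_nonneg) auto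
    also have "0 \<le> penalty d n \<kappa> R" using \<kappa> ln0 by (simp add: penalty_def)
    finally show ?thesis .
  qed
  then have "measure (graph_law TYPE('d) p n) ?S0 \<le> measure (graph_law TYPE('d) p n)
     {A. \<delta>\<^sub>2 (est A) (lambda_star_trunc d p R)
         \<le> 4 * \<delta>\<^sub>2 (lambda_star_trunc d p R) (lambda_star d p) + penalty d n \<kappa> R}"
    (is "_ \<le> measure _ ?S")
    by (intro G.finite_measure_mono) auto
  ultimately have "1 - 3 * \<alpha> \<le> G.prob ?S" by simp
  moreover have "G.prob (UNIV - ?S) = 1 - G.prob ?S" using G.prob_compl[of ?S] by simp
  moreover have "UNIV - ?S = {A. \<not> \<delta>\<^sub>2 (est A) (lambda_star_trunc d p R)
         \<le> 4 * \<delta>\<^sub>2 (lambda_star_trunc d p R) (lambda_star d p) + penalty d n \<kappa> R}" by auto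
  ultimately show ?thesis by (simp add: \<alpha>_def)
qed

lemma (in prob_space) expectation_le_two_level:
  fixes f :: "'a \<Rightarrow> real"
  assumes f: "f \<in> borel_measurable M" and bad: "Bad \<in> sets M"
    and nn: "AE x in M. 0 \<le> f x" and good: "AE x in M. x \<notin> Bad \<longrightarrow> f x \<le> a"
    and all: "AE x in M. f x \<le> b" and ab: "0 \<le> a" "0 \<le> b"
  shows "expectation f \<le> a + b * prob Bad"
proof -
  have "integrable M f"
    by (rule integrable_const_bound[of _ b]) (use nn all in \<open>eventually_elim, auto\<close>, rule f)
  moreover have "integrable M (\<lambda>x. a + b * indicator Bad x)"
    using bad by (auto intro: integrable_real_indicator simp: emeasure_eq_measure)
  moreover have "AE x in M. f x \<le> a + b * indicator Bad x"
    using good all by eventually_elim (use ab in \<open>auto simp: indicator_def\<close>)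
  ultimately have "expectation f \<le> expectation (\<lambda>x. a + b * indicator Bad x)"
    by (rule integral_mono_AE)
  also have "\<dots> = a + b * prob Bad"
    using bad by (simp add: emeasure_eq_measure prob_space)
  finally show ?thesis .
qed

text \<open>A union bound over at most n / 2 resolutions gives the bad event probability of order
  the inverse square of n; multiplied by the crude squared error of order n, it contributes order 1
  / n.\<close>

lemma adaptive_risk_bound:
  fixes n Rmax :: nat
  assumes dim: "d = CARD('d::finite)" and d: "d \<ge> 3" and conc: "concentration_constant TYPE('d) \<kappa>\<^sub>0"
    and \<kappa>: "\<kappa> > 0" "\<kappa> \<ge> \<kappa>\<^sub>0 * sqrt 5" and s: "s > 0"
    and p: "envelope p" "p \<in> sobolev_space d s" and n: "2 * cum_dim d Rmax \<le> n"
    and est: "\<And>A R. A \<in> adjacency_matrices n \<Longrightarrow> R \<in> {1..Rmax} \<Longrightarrow> is_estimate d n R A (est A R)"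
    and adaptive: "\<And>A. A \<in> adjacency_matrices n \<Longrightarrow> is_adaptive_resolution d n \<kappa> Rmax (est A) (Rhat A)"
    and R: "R \<in> {1..Rmax}"
  shows "(\<integral>A. (\<delta>\<^sub>2 (est A (Rhat A)) (lambda_star d p))\<^sup>2 \<partial>graph_law TYPE('d) p n)
     \<le> (23 * (sobolev_norm d s p * real R powr (- s)) + 5 * penalty d n \<kappa> R)\<^sup>2
       + 3 * (4 + (sobolev_norm d s p)\<^sup>2) / real n"
proof -
  interpret G: prob_space "graph_law TYPE('d) p n" by (rule prob_space_graph_law[OF p(1)])
  note [simp] = sets_graph_law[OF p(1)]
  let ?x = "lambda_star d p" and ?X = "lambda_star_trunc d p" and ?N = "sobolev_norm d s p"
  let ?t = "?N * real R powr (- s)"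
  note N0 = sobolev_norm_nonneg[OF d s p(2)]
  note x = lambda_star_l2[OF d s p(2)] and X = lambda_star_trunc_l2[OF d s p(2)]
  \<comment> \<open>Degrees are fewer than dimensions, so the dimension constraint also limits the
    number of events in the union bound.\<close>
  have Rmax: "2 * Rmax \<le> n" "1 \<le> Rmax" using cum_dim_gt[OF d, of Rmax] n R by auto
  have cum: "2 * cum_dim d R' \<le> n" if "R' \<in> {1..Rmax}" for R'
    using strict_mono_less_eq[OF strict_mono_cum_dim[OF d], of R' Rmax] that n by simp
  define bad where "bad R' = {A. \<not> \<delta>\<^sub>2 (est A R') (?X R') \<le> 4 * \<delta>\<^sub>2 (?X R') ?x + penalty d n \<kappa> R'}" for R'
  define Bad where "Bad = (\<Union>R'\<in>{1..Rmax}. bad R')"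
  have "G.prob Bad \<le> (\<Sum>R'\<in>{1..Rmax}. G.prob (bad R'))"
    unfolding Bad_def by (rule G.finite_measure_subadditive_finite) auto
  also have "\<dots> \<le> (\<Sum>R'\<in>{1..Rmax}. 3 / real n ^ 3)"
  proof (rule sum_mono)
    fix R' assume R': "R' \<in> {1..Rmax}"
    show "G.prob (bad R') \<le> 3 / real n ^ 3"
      unfolding bad_def by (rule concentration_at_resolution[OF dim d conc \<kappa> p(1) cum[OF R'] est[OF _ R']])
  qed
  also have "\<dots> = real Rmax * (3 / real n ^ 3)" by simp
  also have "\<dots> \<le> (real n / 2) * (3 / real n ^ 3)"
    using Rmax by (intro mult_right_mono) auto
  finally have Bad: "G.prob Bad \<le> (real n / 2) * (3 / real n ^ 3)" .
  have el2: "l2_summable (est A R')" "l2_norm (est A R') \<le> 2 * sqrt (real n)"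
    if "A \<in> adjacency_matrices n" "R' \<in> {1..Rmax}" for A R'
    using estimate_l2[OF est[OF that] that(1)] cum[OF that(2)] by auto
  have Rhat: "Rhat A \<in> {1..Rmax}" if "A \<in> adjacency_matrices n" for A
    using adaptive[OF that] by (auto simp: is_adaptive_resolution_def is_arg_min_def)
  note AE = AE_graph_law[OF p(1), of n, where 'd = 'd]
  have "G.expectation (\<lambda>A. (\<delta>\<^sub>2 (est A (Rhat A)) ?x)\<^sup>2)
      \<le> (23 * ?t + 5 * penalty d n \<kappa> R)\<^sup>2 + (2 * sqrt (real n) + ?N)\<^sup>2 * G.prob Bad"
  proof (rule G.expectation_le_two_level)
    show "(\<lambda>A. (\<delta>\<^sub>2 (est A (Rhat A)) ?x)\<^sup>2) \<in> borel_measurable (graph_law TYPE('d) p n)"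
      unfolding measurable_def by auto
    show "AE A in graph_law TYPE('d) p n. A \<notin> Bad \<longrightarrow>
        (\<delta>\<^sub>2 (est A (Rhat A)) ?x)\<^sup>2 \<le> (23 * ?t + 5 * penalty d n \<kappa> R)\<^sup>2"
      using AE
    proof (eventually_elim, intro impI power_mono)
      fix A assume A: "A \<in> adjacency_matrices n" and nb: "A \<notin> Bad"
      show "\<delta>\<^sub>2 (est A (Rhat A)) ?x \<le> 23 * ?t + 5 * penalty d n \<kappa> R"
      proof (rule adaptive_oracle_bound[OF adaptive[OF A] \<kappa>(1) _ R el2(1)[OF A] x(1) X])
        show "1 \<le> n" using Rmax by simp
        fix R' assume "R \<le> R'"
        then show "\<delta>\<^sub>2 (?X R') ?x \<le> ?t" "\<delta>\<^sub>2 (?X R') (?X R) \<le> ?t"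
          using delta_trunc_le[OF d s p(2)] R by auto
      next
        fix R' assume "R' \<in> {1..Rmax}"
        then show "\<delta>\<^sub>2 (est A R') (?X R') \<le> 4 * \<delta>\<^sub>2 (?X R') ?x + penalty d n \<kappa> R'"
          using nb by (auto simp: Bad_def bad_def)
      qed
      show "0 \<le> \<delta>\<^sub>2 (est A (Rhat A)) ?x" by (intro delta_nonneg el2 A Rhat x)
    qed
    show "AE A in graph_law TYPE('d) p n. (\<delta>\<^sub>2 (est A (Rhat A)) ?x)\<^sup>2 \<le> (2 * sqrt (real n) + ?N)\<^sup>2"
      using AE
    proof (eventually_elim, intro power_mono)
      fix A assume A: "A \<in> adjacency_matrices n"
      note e = el2[OF A Rhat[OF A]]
      have "\<delta>\<^sub>2 (est A (Rhat A)) ?x \<le> l2_norm (est A (Rhat A)) + l2_norm ?x"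
        using delta_le_norm[OF e(1) x(1)] l2_diff(2)[OF e(1) x(1)] by linarith
      then show "\<delta>\<^sub>2 (est A (Rhat A)) ?x \<le> 2 * sqrt (real n) + ?N" using e(2) x(2) by linarith
      show "0 \<le> \<delta>\<^sub>2 (est A (Rhat A)) ?x" by (intro delta_nonneg e x)
    qed
  qed (auto)
  also have "(2 * sqrt (real n) + ?N)\<^sup>2 * G.prob Bad \<le> 3 * (4 + ?N\<^sup>2) / real n"
  proof -
    have n1: "1 \<le> real n" using Rmax by simp
    have "0 \<le> (2 * sqrt (real n) - ?N)\<^sup>2" by simp
    then have "(2 * sqrt (real n) + ?N)\<^sup>2 \<le> 8 * real n + 2 * ?N\<^sup>2"
      by (simp add: power2_sum power2_diff power_mult_distrib)
    also have "\<dots> \<le> 2 * (4 + ?N\<^sup>2) * real n"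
      using mult_left_mono[OF n1, of "2 * ?N\<^sup>2"] by (simp add: algebra_simps)
    finally have "(2 * sqrt (real n) + ?N)\<^sup>2 * G.prob Bad
        \<le> (2 * (4 + ?N\<^sup>2) * real n) * ((real n / 2) * (3 / real n ^ 3))"
      using Bad by (intro mult_mono) (auto simp: add_nonneg_nonneg)
    also have "\<dots> = 3 * (4 + ?N\<^sup>2) / real n"
      using n1 by (simp add: field_simps power3_eq_cube)
    finally show ?thesis .
  qed
  finally show ?thesis by simp
qed

section \<open>Balancing bias and penalty\<close>

text \<open>The ideal real resolution x is scaled by \<open>min c 1\<close> and rounded down. The
  scaling keeps the result below both \<open>Rmax\<close> and x.\<close>

lemma resolution_choice:
  fixes n Rmax :: nat and c m :: real
  assumes c: "c > 0" and m: "m > 0" and n: "1 \<le> ln (real n)" "n \<ge> 1"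
    and Rmax: "c * real n powr m \<le> real Rmax"
  defines "x \<equiv> (real n / ln (real n)) powr m"
  obtains R where "R \<in> {1..Rmax}" "min c 1 / 2 * x \<le> real R" "real R \<le> x" "1 \<le> x"
proof -
  have "ln (real n) \<le> real n" using n ln_bound[of "real n"] by simp
  then have "1 \<le> real n / ln (real n)" using n by (subst le_divide_eq_1_pos) linarith+
  then have x1: "1 \<le> x" unfolding x_def using m by (intro ge_one_powr_ge_zero) auto
  have "x \<le> real n powr m"
    unfolding x_def using n m mult_left_mono[of 1 "ln (real n)" "real n"]
    by (intro powr_mono2) (auto simp: divide_le_eq)
  then have cx: "min c 1 * x \<le> real Rmax"
    using Rmax c x1 mult_mono[of "min c 1" c x "real n powr m"] by simp
  have "0 < real Rmax" using Rmax c n by (intro less_le_trans[OF _ Rmax]) auto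
  then have Rmax1: "1 \<le> Rmax" by simp
  have cx': "min c 1 * x \<le> x" using x1 mult_right_mono[of "min c 1" 1 x] by simp
  define R where "R = max 1 (nat \<lfloor>min c 1 * x\<rfloor>)"
  have pos: "0 \<le> min c 1 * x" using c x1 by simp
  show ?thesis
  proof
    have le: "real (nat \<lfloor>min c 1 * x\<rfloor>) \<le> min c 1 * x" using pos by simp
    from order_trans[OF this cx] show "R \<in> {1..Rmax}" unfolding R_def using Rmax1 by simp
    from order_trans[OF le cx'] show "real R \<le> x" unfolding R_def of_nat_max using x1 by simp
    show "min c 1 / 2 * x \<le> real R"
    \<comment> \<open>Below 2 the value R = 1 already reaches half of the target; from 2 on,
      rounding loses at most 1, which is at most half.\<close>
    proof (cases "min c 1 * x < 2")
      case True
      then show ?thesis by (simp add: R_def)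
    next
      case False
      have "min c 1 * x - 1 \<le> real (nat \<lfloor>min c 1 * x\<rfloor>)" by linarith
      also have "\<dots> \<le> real R" by (simp add: R_def)
      finally show ?thesis using False by linarith
    qed
  qed (rule x1)
qed

text \<open>The exponent defining x is chosen so that ln n / n is the power -(2 s + d - 1) of x. A
  variance of order the power d - 1 of x times ln n / n then has the order of the squared bias, the
  power -2 s.\<close>

lemma rate_bound:
  fixes n R :: nat
  assumes d: "d \<ge> 3" and s: "s > 0" and n: "1 \<le> ln (real n)" "n \<ge> 1" and N: "N \<ge> 0" and b: "b > 0"
    and x: "x = (real n / ln (real n)) powr (1 / (2 * s + real d - 1))" "1 \<le> x"
    and R: "1 \<le> R" "b * x \<le> real R" "real R \<le> x"
  shows "(23 * (N * real R powr (- s)) + 5 * penalty d n \<kappa> R)\<^sup>2 + 3 * (4 + N\<^sup>2) / real n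
     \<le> (1058 * N\<^sup>2 * (b powr (- s))\<^sup>2 + 100 * \<kappa>\<^sup>2 * real d ^ (d - 1) + 3 * (4 + N\<^sup>2)) * x powr (- (2 * s))"
proof -
  have two: "(u + v)\<^sup>2 \<le> 2 * u\<^sup>2 + 2 * v\<^sup>2" for u v :: real
    using sum_squares_bound[of u v] by (simp add: power2_sum)
  have xs: "x powr (- (2 * s)) = (x powr (- s))\<^sup>2"
    using x(2) by (simp add: power2_eq_square flip: powr_add)
  have ln_n: "ln (real n) / real n = x powr (- (2 * s + real d - 1))"
  proof -
    have "1 / a * (- a) = - 1" if "a > 0" for a :: real using that by simp
    moreover have "0 < 2 * s + real d - 1" using s d by simp
    ultimately have "1 / (2 * s + real d - 1) * (- (2 * s + real d - 1)) = - 1" .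
    then have "x powr (- (2 * s + real d - 1)) = (real n / ln (real n)) powr (- 1)"
      unfolding x(1) powr_powr by simp
    then show ?thesis using n by (simp add: powr_minus)
  qed
  have "real R powr (- s) \<le> (b * x) powr (- s)"
    using R b x(2) s by (intro powr_mono2') auto
  then have "N * real R powr (- s) \<le> N * (b powr (- s) * x powr (- s))"
    using N b x(2) by (intro mult_left_mono) (auto simp: powr_mult)
  then have "(N * real R powr (- s))\<^sup>2 \<le> (N * (b powr (- s) * x powr (- s)))\<^sup>2"
    using N by (intro power_mono) auto
  then have bias: "(N * real R powr (- s))\<^sup>2 \<le> N\<^sup>2 * (b powr (- s))\<^sup>2 * x powr (- (2 * s))"
    unfolding xs by (simp only: power_mult_distrib mult.assoc)
  have "real (cum_dim d R) \<le> 2 * real d ^ (d - 1) * x ^ (d - 1)"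
    by (rule order_trans[OF cum_dim_bound[OF d R(1)]]) (intro mult_left_mono power_mono, use R(3) in auto)
  then have "real (cum_dim d R) * (ln (real n) / real n)
      \<le> 2 * real d ^ (d - 1) * x ^ (d - 1) * (ln (real n) / real n)"
    using n by (intro mult_right_mono) auto
  also have "\<dots> = 2 * real d ^ (d - 1) * (x powr real (d - 1) * x powr (- (2 * s + real d - 1)))"
    using x(2) by (simp add: ln_n powr_realpow)
  also have "x powr real (d - 1) * x powr (- (2 * s + real d - 1)) = x powr (- (2 * s))"
    using d by (simp add: of_nat_diff flip: powr_add)
  finally have "\<kappa>\<^sup>2 * (real (cum_dim d R) * (ln (real n) / real n)) \<le> \<kappa>\<^sup>2 * (2 * real d ^ (d - 1) * x powr (- (2 * s)))"
    by (intro mult_left_mono) auto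
  then have var: "(penalty d n \<kappa> R)\<^sup>2 \<le> 2 * \<kappa>\<^sup>2 * real d ^ (d - 1) * x powr (- (2 * s))"
    using n by (simp add: penalty_def power_mult_distrib mult_ac)
  \<comment> \<open>Here ln n at least 1 is used: the contribution of the bad event is dominated by
    the main rate.\<close>
  have "1 / real n \<le> ln (real n) / real n" using n by (intro divide_right_mono) auto
  also have "\<dots> \<le> x powr (- (2 * s))" unfolding ln_n using x(2) d by (intro powr_mono) auto
  finally have "3 * (4 + N\<^sup>2) * (1 / real n) \<le> 3 * (4 + N\<^sup>2) * x powr (- (2 * s))"
    by (intro mult_left_mono) (auto simp: add_nonneg_nonneg)
  then have tail: "3 * (4 + N\<^sup>2) / real n \<le> 3 * (4 + N\<^sup>2) * x powr (- (2 * s))" by simp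
  have "(23 * (N * real R powr (- s)) + 5 * penalty d n \<kappa> R)\<^sup>2
      \<le> 2 * (23 * (N * real R powr (- s)))\<^sup>2 + 2 * (5 * penalty d n \<kappa> R)\<^sup>2"
    by (rule two)
  also have "\<dots> = 1058 * (N * real R powr (- s))\<^sup>2 + 50 * (penalty d n \<kappa> R)\<^sup>2"
    unfolding power_mult_distrib[of 23] power_mult_distrib[of 5] by simp
  also have "\<dots> \<le> 1058 * (N\<^sup>2 * (b powr (- s))\<^sup>2 * x powr (- (2 * s)))
      + 50 * (2 * \<kappa>\<^sup>2 * real d ^ (d - 1) * x powr (- (2 * s)))"
    using bias var by linarith
  finally show ?thesis using tail by (simp add: distrib_right mult.assoc)
qed

theorem corollary8:
  fixes \<kappa>\<^sub>0 \<kappa> s c N :: real and d :: nat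
  assumes "d = CARD('d::finite)" and "d \<ge> 3"
    and "concentration_constant TYPE('d) \<kappa>\<^sub>0"
    and "\<kappa> > 0" and "\<kappa> \<ge> \<kappa>\<^sub>0 * sqrt 5"
    and "s > 0" and "c > 0"
  shows "\<exists>C>0. \<forall>(p :: real \<Rightarrow> real) (n :: nat) (Rmax :: nat)
              (est :: real mat \<Rightarrow> nat \<Rightarrow> nat \<Rightarrow> real) (Rhat :: real mat \<Rightarrow> nat).
           envelope p \<longrightarrow>
           p \<in> sobolev_space d s \<longrightarrow>
           sobolev_norm d s p = N \<longrightarrow>
           2 * cum_dim d Rmax \<le> n \<longrightarrow>
           c * real n powr (1 / (2 * s + real d - 1)) \<le> real Rmax \<longrightarrow>
           (\<forall>A\<in>adjacency_matrices n. \<forall>R\<in>{1..Rmax}. is_estimate d n R A (est A R)) \<longrightarrow>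
           (\<forall>A\<in>adjacency_matrices n. is_adaptive_resolution d n \<kappa> Rmax (est A) (Rhat A)) \<longrightarrow>
           (\<integral>A. (\<delta>\<^sub>2 (est A (Rhat A)) (lambda_star d p))\<^sup>2 \<partial>graph_law TYPE('d) p n)
             \<le> C * (real n / ln (real n)) powr (- (2 * s / (2 * s + (real d - 1))))"
proof -
  \<comment> \<open>The ratio \<open>?b\<close> is the one guaranteed by
    \<open>resolution_choice\<close>; through it \<open>?C\<close> depends on c, and otherwise only
    on N, s, d and \<kappa>.\<close>
  let ?b = "min c 1 / 2" and ?m = "1 / (2 * s + real d - 1)"
  let ?C = "1058 * N\<^sup>2 * (?b powr (- s))\<^sup>2 + 100 * \<kappa>\<^sup>2 * real d ^ (d - 1) + 3 * (4 + N\<^sup>2)"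
  show ?thesis
  proof (rule exI[of _ ?C], intro conjI allI impI)
    show "0 < ?C" by (simp add: add_nonneg_pos add_pos_nonneg)
    fix p :: "real \<Rightarrow> real" and n Rmax :: nat
      and est :: "real mat \<Rightarrow> nat \<Rightarrow> nat \<Rightarrow> real" and Rhat :: "real mat \<Rightarrow> nat"
    assume p: "envelope p" "p \<in> sobolev_space d s" "sobolev_norm d s p = N"
      and n: "2 * cum_dim d Rmax \<le> n" and Rmax: "c * real n powr ?m \<le> real Rmax"
      and est: "\<forall>A\<in>adjacency_matrices n. \<forall>R\<in>{1..Rmax}. is_estimate d n R A (est A R)"
      and adaptive: "\<forall>A\<in>adjacency_matrices n. is_adaptive_resolution d n \<kappa> Rmax (est A) (Rhat A)"
    have "1 \<le> n" using n cum_dim_gt[OF assms(2), of Rmax] by simp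
    \<comment> \<open>The lower bound on \<open>Rmax\<close> forces at least one degree beyond 0,
      hence at least 4 coordinates and n at least 8, which makes ln n at least 1.\<close>
    then have "0 < real Rmax" using assms(7) by (intro less_le_trans[OF _ Rmax]) auto
    then have "1 \<le> Rmax" by simp
    then have "cum_dim d 1 \<le> cum_dim d Rmax"
      using strict_mono_less_eq[OF strict_mono_cum_dim[OF assms(2)]] by simp
    moreover have "4 \<le> cum_dim d 1" using assms(2) by (simp add: cum_dim_def harm_dim_def)
    ultimately have "8 \<le> n" using n by simp
    then have "exp 1 \<le> real n" using exp_le by linarith
    then have ln1: "1 \<le> ln (real n)" using \<open>8 \<le> n\<close> by (subst ln_ge_iff) auto
    have m: "0 < ?m" using assms(2,6) by simp
    define x where "x = (real n / ln (real n)) powr ?m"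
    obtain R where R: "R \<in> {1..Rmax}" "?b * x \<le> real R" "real R \<le> x" "1 \<le> x"
      using resolution_choice[OF assms(7) m ln1 \<open>1 \<le> n\<close> Rmax] unfolding x_def by blast
    have "(\<integral>A. (\<delta>\<^sub>2 (est A (Rhat A)) (lambda_star d p))\<^sup>2 \<partial>graph_law TYPE('d) p n)
        \<le> (23 * (N * real R powr (- s)) + 5 * penalty d n \<kappa> R)\<^sup>2 + 3 * (4 + N\<^sup>2) / real n"
      using adaptive_risk_bound[OF assms(1-6) p(1,2) n _ _ R(1), of est Rhat] est adaptive
      unfolding p(3) by blast
    also have "\<dots> \<le> ?C * x powr (- (2 * s))"
      using sobolev_norm_nonneg[OF assms(2,6) p(2)] R assms(7)
      by (intro rate_bound[OF assms(2,6) ln1 \<open>1 \<le> n\<close> _ _ x_def]) (auto simp: p(3))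
    also have "x powr (- (2 * s)) = (real n / ln (real n)) powr (- (2 * s / (2 * s + (real d - 1))))"
      by (simp add: x_def powr_powr diff_add_eq add_diff_eq)
    finally show "(\<integral>A. (\<delta>\<^sub>2 (est A (Rhat A)) (lambda_star d p))\<^sup>2 \<partial>graph_law TYPE('d) p n)
        \<le> ?C * (real n / ln (real n)) powr (- (2 * s / (2 * s + (real d - 1))))" .
  qed
qed

end
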